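(* Let $a, n$ be positive integers and let $a = \prod_{p \mid a} p^{t_p}$ be the prime factorization of $a$. For every prime divisor $p$ of $a$, define integers $r_p \geq 0$ and $m_p \geq 1$ by $n = p^{r_p} m_p$ with $p \nmid m_p$. Then the order of $\mathrm{RC}_n(\mathbb{Z}/a\mathbb{Z})$ is $$\prod_{p \mid a} \left( p^{n(t_p - 1)} \prod_{d \mid m_p} \left( (p^{\mathrm{ord}_d(p)} - 1)^{\phi(d)/\mathrm{ord}_d(p)} \cdot p^{(p^{r_p} - 1) \phi(d)} \right) \right),$$ where the outer product runs over the prime divisors $p$ of $a$ and the inner one over the positive divisors $d$ of $m_p$.
   Context: A matrix $(a_{i,j})_{1 \leq i,j \leq n}$ is called circulant if $a_{i,j+1} = a_{i-1,j}$ for all $1 \leq i,j \leq n$, where indices are read modulo $n$. For a commutative ring $R$, $\mathrm{RC}_n(R)$ denotes the group (under matrix multiplication) of regular, i.e. invertible over $R$, circulant $(n\times n)$-matrices over $R$. For positive integers $d,k$ with $\gcd(d,k)=1$, $\mathrm{ord}_d(k)$ is the order of $k$ in the multiplicative group $(\mathbb{Z}/d\mathbb{Z})^*$ (so $\mathrm{ord}_1(k)=1$). $\phi$ is the Euler function. *)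

theory Defs
  imports
    "HOL-Algebra.Algebra"
    "HOL-Number_Theory.Number_Theory"
    "Jordan_Normal_Form.Matrix"
begin

text \<open>
  The matrix product of Jordan_Normal_Form is tied to type classes. The coefficient ring here
  (such as \<^const>\<open>ZFact\<close>) is a ring record, so only the matrix type is
  reused and the operations are taken from the record.
\<close>

definition square_mats :: "('a, 'b) ring_scheme \<Rightarrow> nat \<Rightarrow> 'a mat monoid" where
  "square_mats R n =
    \<lparr> carrier = {A \<in> carrier_mat n n. elements_mat A \<subseteq> carrier R},
      monoid.mult = (\<lambda>A B. mat n n (\<lambda>(i, j). \<Oplus>\<^bsub>R\<^esub>k\<in>{..<n}. A $$ (i, k) \<otimes>\<^bsub>R\<^esub> B $$ (k, j))),
      one = mat n n (\<lambda>(i, j). if i = j then \<one>\<^bsub>R\<^esub> else \<zero>\<^bsub>R\<^esub>) \<rparr>"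

text \<open>
  Indices run over \<open>0, \<dots>, n - 1\<close>. As subtraction on \<^typ>\<open>nat\<close> truncates,
  the index \<open>i - 1\<close> modulo \<open>n\<close> is written as \<open>(i + n - 1) mod n\<close>.
\<close>

definition circulant :: "nat \<Rightarrow> 'a mat \<Rightarrow> bool" where
  "circulant n A \<longleftrightarrow> A \<in> carrier_mat n n \<and>
    (\<forall>i<n. \<forall>j<n. A $$ (i, (j + 1) mod n) = A $$ ((i + n - 1) mod n, j))"

text \<open>
  Invertibility is invertibility in the full matrix monoid: the inverse is not required to be
  circulant.
\<close>

definition RC :: "nat \<Rightarrow> ('a, 'b) ring_scheme \<Rightarrow> 'a mat monoid" where
  "RC n R = (square_mats R n)\<lparr>carrier := {A \<in> Units (square_mats R n). circulant n A}\<rparr>"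

end

theory Submission imports Defs "HOL-Computational_Algebra.Polynomial" begin

text \<open>
  A circulant matrix over \<open>\<int>/a\<close> corresponds to a class of \<open>\<int>[X]\<close> modulo \<open>(a, X^n - 1)\<close>, and it
  is invertible iff the class is a unit, so the units of this quotient ring are counted. The Chinese
  remainder theorem reduces to \<open>a = p^t\<close>. With \<open>n = p^r m\<close>, Frobenius makes the kernel of the
  reduction to \<open>(p, X^m - 1)\<close> nilpotent, so units lift and the count only gets multiplied by the
  ratio of the ring sizes. For \<open>p\<close> not dividing \<open>m\<close>, choose a prime ideal \<open>M\<close> above \<open>(p, X^m - 1)\<close>
  modulo which \<open>X\<close> has order exactly \<open>m\<close>. The Fourier transform \<open>f \<mapsto> (f(X^j) mod M)\<close>, with \<open>j\<close>
  running over representatives of the orbits of multiplication by \<open>p\<close> on \<open>\<int>/m\<close>, is an isomorphism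
  onto a product of fields; the orbit of \<open>j\<close> contributes a field with \<open>p^ord_d(p)\<close> elements, where
  \<open>d = m / gcd(j, m)\<close>, and each divisor \<open>d\<close> of \<open>m\<close> arises from \<open>\<phi>(d) / ord_d(p)\<close> orbits.
\<close>

hide_const (open) Divisibility.prime

section \<open>Ideals\<close>

text \<open>Congruence modulo \<open>I\<close> is written as membership of a difference, so ideals
  of one ring are compared without forming quotient types.\<close>

locale ring_ideal =
  fixes I :: "'a :: comm_ring_1 set"
  assumes zero_mem: "0 \<in> I"
    and add_mem: "f \<in> I \<Longrightarrow> g \<in> I \<Longrightarrow> f + g \<in> I"
    and mult_mem: "f \<in> I \<Longrightarrow> h * f \<in> I"
begin

lemma mult_mem_right: "f \<in> I \<Longrightarrow> f * h \<in> I"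
  by (metis mult_mem mult.commute)

lemma uminus_mem: "f \<in> I \<Longrightarrow> - f \<in> I"
  using mult_mem[of f "- 1"] by simp

lemma diff_mem: "f \<in> I \<Longrightarrow> g \<in> I \<Longrightarrow> f - g \<in> I"
  using add_mem[of f "- g"] uminus_mem by simp

lemma dvd_mem: "f \<in> I \<Longrightarrow> f dvd g \<Longrightarrow> g \<in> I"
  by (auto simp: dvd_def intro: mult_mem_right)

lemma sum_mem: "(\<And>i. i \<in> S \<Longrightarrow> F i \<in> I) \<Longrightarrow> sum F S \<in> I"
  by (induction S rule: infinite_finite_induct) (auto intro: zero_mem add_mem)

lemma cong_trans: "f - g \<in> I \<Longrightarrow> g - h \<in> I \<Longrightarrow> f - h \<in> I"
  using add_mem[of "f - g" "g - h"] by simp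

lemma cong_sym: "f - g \<in> I \<Longrightarrow> g - f \<in> I"
  using uminus_mem[of "f - g"] by simp

lemma cong_mem: "f - g \<in> I \<Longrightarrow> g \<in> I \<Longrightarrow> f \<in> I"
  using add_mem[of "f - g" g] by simp

lemma cong_add: "f - f' \<in> I \<Longrightarrow> g - g' \<in> I \<Longrightarrow> (f + g) - (f' + g') \<in> I"
  using add_mem[of "f - f'" "g - g'"] by (simp add: algebra_simps)

lemma cong_mult: "f - f' \<in> I \<Longrightarrow> g - g' \<in> I \<Longrightarrow> f * g - f' * g' \<in> I"
  using add_mem[OF mult_mem[of "f - f'" g] mult_mem[of "g - g'" f']]
  by (simp add: algebra_simps)

lemma cong_power: "f - g \<in> I \<Longrightarrow> f ^ k - g ^ k \<in> I"
  by (induction k) (auto intro: zero_mem cong_mult)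

lemma cong_sum: "(\<And>i. i \<in> S \<Longrightarrow> F i - G i \<in> I) \<Longrightarrow> sum F S - sum G S \<in> I"
  using sum_mem[of S "\<lambda>i. F i - G i"] by (simp add: sum_subtractf)

text \<open>Expanding \<open>(f * g - 1) ^ k\<close>, every term except \<open>(- 1) ^ k\<close> is
  a multiple of \<open>f\<close>. Hence an inverse modulo a larger ideal whose elements are
  nilpotent modulo \<open>I\<close> gives an inverse modulo \<open>I\<close>.\<close>

lemma unit_nilpotent_lift:
  assumes "(f * g - 1) ^ k \<in> I"
  shows "\<exists>h. f * h - 1 \<in> I"
proof -
  have "\<exists>h. (f * g - 1) ^ k = (- 1) ^ k - f * h"
  proof (induction k)
    case 0
    show ?case by (intro exI[of _ 0]) simp
  next
    case (Suc k)
    then obtain h where "(f * g - 1) ^ k = (- 1) ^ k - f * h" by auto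
    show ?case unfolding power_Suc \<open>(f * g - 1) ^ k = _\<close>
      by (intro exI[of _ "- ((- 1) ^ k * g - f * g * h + h)"]) (simp add: algebra_simps)
  qed
  then obtain h where "(f * g - 1) ^ k = (- 1) ^ k - f * h" by auto
  with assms have "(- 1) ^ k - f * h \<in> I" by simp
  from mult_mem[OF this, of "- ((- 1) ^ k)"]
  show ?thesis
    by (intro exI[of _ "(- 1) ^ k * h"]) (simp add: algebra_simps flip: power_mult_distrib)
qed

end

section \<open>The ring \<int>[X]/(a, X^n - 1) and its units\<close>

text \<open>The ideal \<open>(a, X^n - 1)\<close>. Integer polynomials serve for every modulus, so
  that \<open>a\<close>, \<open>p ^ t\<close> and \<open>p\<close> are treated inside a single
  ring.\<close>

definition cyc_ideal :: "nat \<Rightarrow> nat \<Rightarrow> int poly set" where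
  "cyc_ideal a n = {of_nat a * h + (monom 1 n - 1) * k | h k. True}"

lemma cyc_idealI: "f = of_nat a * h + (monom 1 n - 1) * k \<Longrightarrow> f \<in> cyc_ideal a n"
  by (auto simp: cyc_ideal_def)

interpretation cyc: ring_ideal "cyc_ideal a n" for a n
proof
  show "0 \<in> cyc_ideal a n" by (rule cyc_idealI[of _ _ 0 _ 0]) simp
next
  fix f g assume "f \<in> cyc_ideal a n" "g \<in> cyc_ideal a n"
  then obtain h k h' k' where "f = of_nat a * h + (monom 1 n - 1) * k"
    "g = of_nat a * h' + (monom 1 n - 1) * k'" by (auto simp: cyc_ideal_def)
  then show "f + g \<in> cyc_ideal a n"
    by (intro cyc_idealI[of _ _ "h + h'" _ "k + k'"]) (simp add: algebra_simps)
next
  fix f h assume "f \<in> cyc_ideal a n"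
  then obtain h' k' where "f = of_nat a * h' + (monom 1 n - 1) * k'" by (auto simp: cyc_ideal_def)
  show "h * f \<in> cyc_ideal a n" unfolding \<open>f = _\<close>
    by (intro cyc_idealI[of _ _ "h * h'" _ "h * k'"]) (simp add: algebra_simps)
qed

lemma of_nat_mem_cyc_ideal: "of_nat a \<in> cyc_ideal a n"
  by (rule cyc_idealI[of _ _ 1 _ 0]) simp

lemma monom_diff_mem_cyc_ideal: "monom 1 n - 1 \<in> cyc_ideal a n"
  by (rule cyc_idealI[of _ _ 0 _ 1]) simp

lemma monom_mod_cong: "monom c k - monom c (k mod n) \<in> cyc_ideal a n"
proof -
  have "monom 1 n ^ (k div n) - 1 ^ (k div n) \<in> cyc_ideal a n"
    by (rule cyc.cong_power) (rule monom_diff_mem_cyc_ideal)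
  from cyc.mult_mem[OF this, of "monom c (k mod n)"] show ?thesis
    by (simp add: monom_power mult_monom right_diff_distrib)
qed

lemma of_nat_dvd_iff_coeff:
  "(of_nat a :: int poly) dvd f \<longleftrightarrow> (\<forall>i. int a dvd coeff f i)"
  by (metis const_poly_dvd_iff of_nat_poly of_int_of_nat_eq)

lemma of_nat_dvd_mem: "of_nat a dvd f \<Longrightarrow> f \<in> cyc_ideal a n"
  using cyc.dvd_mem of_nat_mem_cyc_ideal by blast

text \<open>All cross terms contain \<open>X^n - 1\<close>. This serves both the Chinese remainder
  theorem and the passage from \<open>p\<close> to \<open>p ^ t\<close>.\<close>

lemma cyc_ideal_mult:
  assumes "f \<in> cyc_ideal a n" "g \<in> cyc_ideal b n"
  shows "f * g \<in> cyc_ideal (a * b) n"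
proof -
  obtain u v u' v' where f: "f = of_nat a * u + (monom 1 n - 1) * v"
    and g: "g = of_nat b * u' + (monom 1 n - 1) * v'" using assms by (auto simp: cyc_ideal_def)
  have "f * g = of_nat (a * b) * (u * u') + (monom 1 n - 1) * (v * g + of_nat a * u * v')"
    unfolding f g by (simp add: algebra_simps)
  then show ?thesis by (rule cyc_idealI)
qed

lemma cyc_ideal_mono: "b dvd a \<Longrightarrow> m dvd n \<Longrightarrow> cyc_ideal a n \<subseteq> cyc_ideal b m"
proof
  fix f assume "b dvd a" "m dvd n" "f \<in> cyc_ideal a n"
  then obtain h k where f: "f = of_nat a * h + (monom 1 n - 1) * k" by (auto simp: cyc_ideal_def)
  have "of_nat a \<in> cyc_ideal b m"
    using \<open>b dvd a\<close> by (auto intro!: of_nat_dvd_mem elim!: dvdE)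
  moreover have "monom 1 n - 1 \<in> cyc_ideal b m"
    using monom_mod_cong[of 1 n m b] \<open>m dvd n\<close> by (simp add: mod_eq_0_iff_dvd)
  ultimately show "f \<in> cyc_ideal b m"
    unfolding f by (intro cyc.add_mem cyc.mult_mem_right)
qed

text \<open>Comparing coefficients of \<open>f = a h + (X^n - 1) k\<close> at an index \<open>i + n\<close> gives
  \<open>k_(i+n) \<equiv> k_i\<close> modulo \<open>a\<close>; as \<open>k\<close> has finitely many coefficients, all of them vanish.\<close>

lemma mem_cyc_ideal_coeff_dvd:
  assumes "f \<in> cyc_ideal a n" "n > 0" and deg: "\<And>i. i \<ge> n \<Longrightarrow> coeff f i = 0"
  shows "int a dvd coeff f i"
proof -
  obtain h k where f: "f = of_nat a * h + (monom 1 n - 1) * k"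
    using assms(1) by (auto simp: cyc_ideal_def)
  have cf: "coeff f i = int a * coeff h i + (if n \<le> i then coeff k (i - n) else 0) - coeff k i" for i
    by (simp add: f of_nat_poly coeff_monom_mult left_diff_distrib)
  have step: "int a dvd coeff k j - coeff k (j + n)" for j
    using cf[of "j + n"] deg[of "j + n"] by (auto intro!: dvdI[of _ _ "- coeff h (j + n)"])
  have "int a dvd coeff k j - coeff k (j + N * n)" for j N
  proof (induction N)
    case (Suc N)
    from dvd_add[OF this step[of "j + N * n"]] show ?case by (simp add: algebra_simps)
  qed simp
  moreover have "coeff k (j + Suc (degree k) * n) = 0" for j
    using \<open>n > 0\<close> by (intro coeff_eq_0) (cases n, auto)
  ultimately have k: "int a dvd coeff k j" for j
    by (metis diff_zero)
  show ?thesis unfolding cf by (intro dvd_diff dvd_add) (auto simp: k)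
qed

section \<open>Unique representatives of the residue classes, and the units among them\<close>

definition reps :: "nat \<Rightarrow> nat \<Rightarrow> int poly set" where
  "reps a n = {f. (\<forall>i<n. coeff f i \<in> {0..<int a}) \<and> (\<forall>i\<ge>n. coeff f i = 0)}"

text \<open>The difference has degree below \<open>n\<close>, so \<open>a\<close> divides each of
  its coefficients, and these are smaller than \<open>a\<close> in absolute value.\<close>

lemma reps_cong_eq:
  assumes "f \<in> reps a n" "g \<in> reps a n" "f - g \<in> cyc_ideal a n" "n > 0"
  shows "f = g"
proof (rule poly_eqI)
  fix i
  have "int a dvd coeff (f - g) i"
    using assms by (intro mem_cyc_ideal_coeff_dvd[of _ _ n]) (auto simp: reps_def)
  moreover have "\<bar>coeff (f - g) i\<bar> < int a \<or> coeff (f - g) i = 0"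
    using assms(1,2) by (cases "i < n") (fastforce simp: reps_def)+
  ultimately show "coeff f i = coeff g i"
    using zdvd_not_zless[of "\<bar>coeff (f - g) i\<bar>" "int a"] by auto
qed

lemma coeff_sum_monom: "coeff (\<Sum>i<n. monom (c i) i) j = (if j < n then c j else 0)"
  by (auto simp: coeff_sum coeff_monom)

lemma sum_monom_coeff:
  assumes "\<And>i. i \<ge> n \<Longrightarrow> coeff f i = 0"
  shows "(\<Sum>i<n. monom (coeff f i) i) = f"
  by (rule poly_eqI) (use assms in \<open>auto simp: coeff_sum_monom not_less\<close>)

text \<open>Exponents are folded modulo \<open>n\<close>, which adds up the coefficients at
  congruent exponents into \<open>c i\<close>; then each \<open>c i\<close> is reduced modulo
  \<open>a\<close>.\<close>

lemma reps_cong_ex: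
  assumes "a > 0" "n > 0"
  shows "\<exists>g\<in>reps a n. f - g \<in> cyc_ideal a n"
proof -
  define c where "c i = (\<Sum>j | j \<in> {..degree f} \<and> j mod n = i. coeff f j)" for i
  define g where "g = (\<Sum>i<n. monom (c i mod int a) i)"
  have "f = (\<Sum>j\<le>degree f. monom (coeff f j) j)" by (simp add: poly_as_sum_of_monoms)
  moreover have "(\<Sum>j\<le>degree f. monom (coeff f j) j) - (\<Sum>j\<le>degree f. monom (coeff f j) (j mod n))
    \<in> cyc_ideal a n" by (intro cyc.cong_sum monom_mod_cong)
  moreover have "(\<Sum>j\<le>degree f. monom (coeff f j) (j mod n)) =
    (\<Sum>i<n. \<Sum>j | j \<in> {..degree f} \<and> j mod n = i. monom (coeff f j) (j mod n))"
    using \<open>n > 0\<close> by (intro sum.group[symmetric]) auto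
  moreover have "\<dots> = (\<Sum>i<n. monom (c i) i)"
    by (intro sum.cong refl) (auto simp: c_def monom_sum intro!: sum.cong)
  moreover have "(\<Sum>i<n. monom (c i) i) - g \<in> cyc_ideal a n"
    unfolding g_def by (intro cyc.cong_sum of_nat_dvd_mem)
      (auto simp: of_nat_dvd_iff_coeff coeff_monom diff_monom mod_eq_dvd_iff)
  ultimately have "f - g \<in> cyc_ideal a n" by (metis cyc.cong_trans)
  moreover have "g \<in> reps a n" using \<open>a > 0\<close> by (auto simp: reps_def g_def coeff_sum_monom)
  ultimately show ?thesis by blast
qed

lemma bij_betw_reps:
  "bij_betw (\<lambda>c. \<Sum>i<n. monom (c i) i) (PiE {..<n} (\<lambda>_. {0..<int a})) (reps a n)"
proof (rule bij_betw_byWitness[where f' = "\<lambda>f. restrict (coeff f) {..<n}"])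
  show "\<forall>c\<in>PiE {..<n} (\<lambda>_. {0..<int a}). restrict (coeff (\<Sum>i<n. monom (c i) i)) {..<n} = c"
    by (auto simp: coeff_sum_monom PiE_def extensional_def restrict_def fun_eq_iff)
  show "\<forall>f\<in>reps a n. (\<Sum>i<n. monom (restrict (coeff f) {..<n} i) i) = f"
    by (auto simp: reps_def sum_monom_coeff)
  show "(\<lambda>c. \<Sum>i<n. monom (c i) i) ` PiE {..<n} (\<lambda>_. {0..<int a}) \<subseteq> reps a n"
    by (force simp: reps_def coeff_sum_monom PiE_def)
  show "(\<lambda>f. restrict (coeff f) {..<n}) ` reps a n \<subseteq> PiE {..<n} (\<lambda>_. {0..<int a})"
    by (auto simp: reps_def)
qed

lemma card_reps: "card (reps a n) = a ^ n"
  using bij_betw_same_card[OF bij_betw_reps[of n a]] by (simp add: card_PiE)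

lemma finite_reps: "finite (reps a n)"
  using bij_betw_finite[OF bij_betw_reps[of n a]] by (auto simp: finite_PiE)

definition reduce :: "nat \<Rightarrow> nat \<Rightarrow> int poly \<Rightarrow> int poly" where
  "reduce a n f = (SOME g. g \<in> reps a n \<and> f - g \<in> cyc_ideal a n)"

lemma reduce:
  assumes "a > 0" "n > 0"
  shows "reduce a n f \<in> reps a n" "f - reduce a n f \<in> cyc_ideal a n"
  using someI_ex[of "\<lambda>g. g \<in> reps a n \<and> f - g \<in> cyc_ideal a n"] reps_cong_ex[OF assms, of f]
  by (auto simp: reduce_def)

definition unit_reps :: "nat \<Rightarrow> nat \<Rightarrow> int poly set" where
  "unit_reps a n = {f \<in> reps a n. \<exists>g. f * g - 1 \<in> cyc_ideal a n}"

lemma finite_unit_reps: "finite (unit_reps a n)"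
  by (simp add: unit_reps_def finite_reps)

lemma (in ring_ideal) unit_cong:
  assumes "f - f' \<in> I" "f * g - 1 \<in> I"
  shows "f' * g - 1 \<in> I"
  using diff_mem[OF assms(2) mult_mem[OF assms(1), of g]] by (simp add: algebra_simps)

text \<open>The fibres of the reduction map between the two quotient rings are cosets of its kernel,
  so they all have the same size.\<close>

lemma card_unit_reps_lift:
  assumes pos: "a > 0" "n > 0" "b > 0" "m > 0"
    and le: "cyc_ideal a n \<subseteq> cyc_ideal b m"
    and nil: "\<And>f. f \<in> cyc_ideal b m \<Longrightarrow> \<exists>k. f ^ k \<in> cyc_ideal a n"
  shows "card (unit_reps a n) * b ^ m = card (unit_reps b m) * a ^ n"
proof -
  define fib where "fib g = {f \<in> reps a n. f - g \<in> cyc_ideal b m}" for g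
  have fin: "finite (fib g)" for g by (simp add: fib_def finite_reps)
  have red: "reduce a n f - f \<in> cyc_ideal b m" for f
    using reduce(2)[OF pos(1,2), of f] le cyc.cong_sym by blast
  \<comment> \<open>Translation by \<open>g' - g\<close>, followed by reduction, maps one fibre
    injectively into the other.\<close>
  have le_fib: "card (fib g) \<le> card (fib g')" for g g'
  proof (rule card_inj_on_le)
    show "inj_on (\<lambda>f. reduce a n (f + (g' - g))) (fib g)"
    proof (rule inj_onI)
      fix x y assume x: "x \<in> fib g" and y: "y \<in> fib g"
        and eq: "reduce a n (x + (g' - g)) = reduce a n (y + (g' - g))"
      have "(x + (g' - g)) - (y + (g' - g)) \<in> cyc_ideal a n"
        using reduce(2)[OF pos(1,2), of "x + (g' - g)"] reduce(2)[OF pos(1,2), of "y + (g' - g)"] eq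
          cyc.cong_trans cyc.cong_sym by metis
      then have "x - y \<in> cyc_ideal a n" by simp
      then show "x = y" using x y pos by (intro reps_cong_eq[of x a n y]) (auto simp: fib_def)
    qed
    show "(\<lambda>f. reduce a n (f + (g' - g))) ` fib g \<subseteq> fib g'"
    proof safe
      fix f assume "f \<in> fib g"
      then have "f + (g' - g) - g' \<in> cyc_ideal b m" by (simp add: fib_def)
      with red have "reduce a n (f + (g' - g)) - g' \<in> cyc_ideal b m" by (rule cyc.cong_trans)
      then show "reduce a n (f + (g' - g)) \<in> fib g'"
        using reduce(1)[OF pos(1,2)] by (simp add: fib_def)
    qed
  qed (rule fin)
  define F where "F = card (fib 0)"
  have F: "card (fib g) = F" for g unfolding F_def using le_fib le_antisym by blast
  have disj: "\<forall>g\<in>S. \<forall>g'\<in>S. g \<noteq> g' \<longrightarrow> fib g \<inter> fib g' = {}" if "S \<subseteq> reps b m" for S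
  proof (intro ballI impI, rule ccontr)
    fix g g' assume "g \<in> S" "g' \<in> S" "g \<noteq> g'" "fib g \<inter> fib g' \<noteq> {}"
    then obtain f where "f - g \<in> cyc_ideal b m" "f - g' \<in> cyc_ideal b m" by (auto simp: fib_def)
    then have "g - g' \<in> cyc_ideal b m" using cyc.cong_trans cyc.cong_sym by blast
    with reps_cong_eq[of g b m g'] \<open>g \<in> S\<close> \<open>g' \<in> S\<close> \<open>g \<noteq> g'\<close> that pos show False by blast
  qed
  have ex: "\<exists>g\<in>reps b m. f \<in> fib g" if "f \<in> reps a n" for f
    using reps_cong_ex[OF pos(3,4), of f] that by (auto simp: fib_def)
  have "reps a n = (\<Union>g\<in>reps b m. fib g)"
    using ex by (auto simp: fib_def)
  then have "card (reps a n) = (\<Sum>g\<in>reps b m. card (fib g))"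
    using card_UN_disjoint[OF finite_reps, of b m fib] fin disj[of "reps b m"] by simp
  \<comment> \<open>Counting the whole ring determines the common fibre size
    \<open>F\<close>.\<close>
  then have 1: "a ^ n = b ^ m * F" by (simp add: F card_reps)
  \<comment> \<open>A fibre over a unit consists of units, because an inverse lifts along the
    nilpotent kernel.\<close>
  have "unit_reps a n = (\<Union>g\<in>unit_reps b m. fib g)"
  proof safe
    fix f assume f: "f \<in> unit_reps a n"
    then obtain g where g: "g \<in> reps b m" "f \<in> fib g" using ex by (auto simp: unit_reps_def)
    have "g \<in> unit_reps b m"
      using f g le by (auto simp: unit_reps_def fib_def intro: cyc.unit_cong)
    then show "f \<in> (\<Union>g\<in>unit_reps b m. fib g)" using g by blast
  next
    fix f g assume g: "g \<in> unit_reps b m" and f: "f \<in> fib g"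
    then obtain h where "g * h - 1 \<in> cyc_ideal b m" by (auto simp: unit_reps_def)
    moreover have "g - f \<in> cyc_ideal b m" using f by (auto simp: fib_def intro: cyc.cong_sym)
    ultimately have "f * h - 1 \<in> cyc_ideal b m" by (rule cyc.unit_cong[rotated])
    then obtain k where "(f * h - 1) ^ k \<in> cyc_ideal a n" using nil by blast
    then show "f \<in> unit_reps a n"
      using f cyc.unit_nilpotent_lift by (auto simp: unit_reps_def fib_def)
  qed
  then have "card (unit_reps a n) = (\<Sum>g\<in>unit_reps b m. card (fib g))"
    using card_UN_disjoint[OF finite_unit_reps, of b m fib] fin disj[of "unit_reps b m"]
    by (auto simp: unit_reps_def)
  then have "card (unit_reps a n) = card (unit_reps b m) * F" by (simp add: F)
  then show ?thesis using 1 by simp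
qed

text \<open>Chinese remainder theorem: \<open>D\<close> is injective between finite sets of equal
  size, hence onto, and it matches units with pairs of units.\<close>

lemma card_unit_reps_mult:
  assumes "coprime a b" "a > 0" "b > 0" "n > 0"
  shows "card (unit_reps (a * b) n) = card (unit_reps a n) * card (unit_reps b n)"
proof -
  define D where "D f = (reduce a n f, reduce b n f)" for f
  note ra = reduce[OF assms(2,4)] and rb = reduce[OF assms(3,4)]
  have le: "cyc_ideal (a * b) n \<subseteq> cyc_ideal a n" "cyc_ideal (a * b) n \<subseteq> cyc_ideal b n"
    by (simp_all add: cyc_ideal_mono)
  have inj: "inj_on D (reps (a * b) n)"
  proof (rule inj_onI)
    fix x y assume x: "x \<in> reps (a * b) n" and y: "y \<in> reps (a * b) n" and eq: "D x = D y"
    have eqs: "reduce a n x = reduce a n y" "reduce b n x = reduce b n y"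
      using eq by (simp_all add: D_def)
    have "x - y \<in> cyc_ideal a n" "x - y \<in> cyc_ideal b n"
      using cyc.cong_trans[OF ra(2)[of x, unfolded eqs] cyc.cong_sym[OF ra(2)[of y]]]
        cyc.cong_trans[OF rb(2)[of x, unfolded eqs] cyc.cong_sym[OF rb(2)[of y]]] by simp_all
    moreover have "coeff (x - y) i = 0" if "i \<ge> n" for i using x y that by (auto simp: reps_def)
    ultimately have "int a dvd coeff (x - y) i" "int b dvd coeff (x - y) i" for i
      using mem_cyc_ideal_coeff_dvd \<open>n > 0\<close> by blast+
    then have "int (a * b) dvd coeff (x - y) i" for i
      using divides_mult[of "int a" _ "int b"] assms(1) by simp
    then have "x - y \<in> cyc_ideal (a * b) n"
      by (intro of_nat_dvd_mem) (simp only: of_nat_dvd_iff_coeff simp_thms)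
    then show "x = y" using x y \<open>n > 0\<close> by (intro reps_cong_eq)
  qed
  have sub: "D ` reps (a * b) n \<subseteq> reps a n \<times> reps b n" using ra rb by (auto simp: D_def)
  have "D ` reps (a * b) n = reps a n \<times> reps b n"
    using sub by (intro card_subset_eq)
      (auto simp: finite_reps card_image[OF inj] card_cartesian_product card_reps power_mult_distrib)
  then have surj: "unit_reps a n \<times> unit_reps b n \<subseteq> D ` reps (a * b) n" by (auto simp: unit_reps_def)
  have iff: "f \<in> unit_reps (a * b) n \<longleftrightarrow> D f \<in> unit_reps a n \<times> unit_reps b n"
    if f: "f \<in> reps (a * b) n" for f
  proof
    assume "f \<in> unit_reps (a * b) n"
    then obtain g where "f * g - 1 \<in> cyc_ideal (a * b) n" by (auto simp: unit_reps_def)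
    then have "f * g - 1 \<in> cyc_ideal a n" "f * g - 1 \<in> cyc_ideal b n" using le by blast+
    from cyc.unit_cong[OF ra(2) this(1)] cyc.unit_cong[OF rb(2) this(2)]
    show "D f \<in> unit_reps a n \<times> unit_reps b n"
      using ra(1)[of f] rb(1)[of f] by (auto simp: D_def unit_reps_def)
  next
    assume "D f \<in> unit_reps a n \<times> unit_reps b n"
    then obtain g h where "reduce a n f * g - 1 \<in> cyc_ideal a n" "reduce b n f * h - 1 \<in> cyc_ideal b n"
      by (auto simp: D_def unit_reps_def)
    from cyc.unit_cong[OF cyc.cong_sym[OF ra(2)] this(1)] cyc.unit_cong[OF cyc.cong_sym[OF rb(2)] this(2)]
    have "(f * g - 1) * (f * h - 1) \<in> cyc_ideal (a * b) n" by (rule cyc_ideal_mult)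
    \<comment> \<open>Expanding \<open>(f * g - 1) * (f * h - 1)\<close> leaves \<open>1\<close>
      plus a multiple of \<open>f\<close>, so an inverse modulo both ideals can be read off.\<close>
    from cyc.uminus_mem[OF this]
    have "f * (g + h - f * g * h) - 1 \<in> cyc_ideal (a * b) n"
      by (simp add: algebra_simps)
    then show "f \<in> unit_reps (a * b) n" using f by (auto simp: unit_reps_def)
  qed
  define U where "U = unit_reps a n \<times> unit_reps b n"
  have "f \<in> unit_reps (a * b) n \<longleftrightarrow> f \<in> reps (a * b) n \<and> D f \<in> U" for f
    using iff[of f] by (auto simp: unit_reps_def U_def)
  then have "unit_reps (a * b) n = {f \<in> reps (a * b) n. D f \<in> U}" by blast
  moreover have "U \<subseteq> D ` reps (a * b) n" using surj by (simp add: U_def)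
  ultimately have "D ` unit_reps (a * b) n = U" by (simp only:) (rule equalityI, blast, blast)
  then have "D ` unit_reps (a * b) n = unit_reps a n \<times> unit_reps b n" by (simp only: U_def)
  moreover have "inj_on D (unit_reps (a * b) n)"
    by (rule inj_on_subset[OF inj]) (auto simp: unit_reps_def)
  ultimately show ?thesis by (metis card_image card_cartesian_product)
qed

section \<open>Frobenius and prime ideals\<close>

text \<open>The binomial coefficients strictly between the two ends are divisible by
  \<open>p\<close>.\<close>

lemma prime_dvd_add_power:
  fixes x y :: "'a :: comm_ring_1"
  assumes "prime p"
  shows "of_nat p dvd (x + y) ^ p - (x ^ p + y ^ p)"
proof -
  have "{..p} = insert 0 (insert p {1..<p})" using prime_gt_0_nat[OF assms] by auto
  then have "(x + y) ^ p = x ^ p + y ^ p + (\<Sum>k\<in>{1..<p}. of_nat (p choose k) * x ^ k * y ^ (p - k))"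
    using prime_gt_0_nat[OF assms] by (simp add: binomial_ring add_ac)
  moreover have "of_nat p dvd (of_nat (p choose k) * x ^ k * y ^ (p - k) :: 'a)" if "k \<in> {1..<p}" for k
    using that assms dvd_choose_prime[of k p] by (auto elim!: dvdE)
  ultimately show ?thesis by (auto intro: dvd_sum)
qed

text \<open>Fermat's little theorem, carried over from natural numbers through the nonnegative
  residue \<open>b\<close> of \<open>c\<close>.\<close>

lemma int_prime_dvd_power_diff:
  assumes "prime p"
  shows "int p dvd c ^ p - c"
proof (cases "int p dvd c")
  case True
  then show ?thesis using prime_gt_0_nat[OF assms] by (simp add: dvd_power_le dvd_trans[OF True])
next
  case False
  define b where "b = nat (c mod int p)"
  have "int b = c mod int p" using prime_gt_0_nat[OF assms] by (simp add: b_def)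
  then have bc: "[int b = c] (mod int p)" by (simp add: cong_def)
  have "\<not> p dvd b" using False bc by (metis cong_dvd_iff int_dvd_int_iff)
  then have "[b ^ (p - 1) * b = 1 * b] (mod p)"
    using assms by (intro cong_mult fermat_theorem) auto
  then have "[b ^ p = b] (mod p)" using prime_gt_0_nat[OF assms] by (simp flip: power_Suc2)
  then have "[int b ^ p = int b] (mod int p)" by (metis cong_int_iff of_nat_power)
  then have "[c ^ p = c] (mod int p)" using bc by (meson cong_pow cong_sym cong_trans)
  then show ?thesis by (simp add: cong_iff_dvd_diff)
qed

text \<open>Frobenius is additive modulo \<open>p\<close> and fixes integer constants, so it passes
  through the Horner form of \<open>f\<close> onto the argument \<open>g\<close>.\<close>

lemma pcompose_power_prime_cong:
  assumes "prime p"
  shows "pcompose f g ^ p - pcompose f (g ^ p) \<in> cyc_ideal p n"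
proof (induction f)
  case 0
  show ?case using prime_gt_0_nat[OF assms] by (simp add: cyc.zero_mem power_0_left)
next
  case (pCons c f)
  have "([:c:] + g * pcompose f g) ^ p - ([:c:] ^ p + (g * pcompose f g) ^ p) \<in> cyc_ideal p n"
    by (intro of_nat_dvd_mem prime_dvd_add_power assms)
  moreover have "[:c:] ^ p - [:c:] \<in> cyc_ideal p n"
    using int_prime_dvd_power_diff[OF assms, of c]
    by (intro of_nat_dvd_mem) (auto simp: of_nat_dvd_iff_coeff poly_const_pow coeff_pCons split: nat.split)
  moreover have "(g * pcompose f g) ^ p - g ^ p * pcompose f (g ^ p) \<in> cyc_ideal p n"
    using cyc.mult_mem[OF pCons.IH] by (simp add: power_mult_distrib right_diff_distrib)
  ultimately show ?case
    unfolding pcompose_pCons by (meson cyc.cong_trans cyc.cong_add)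
qed

lemma pcompose_power_cong:
  assumes "prime p"
  shows "pcompose f g ^ (p ^ k) - pcompose f (g ^ (p ^ k)) \<in> cyc_ideal p n"
proof (induction k)
  case 0
  show ?case by (simp add: cyc.zero_mem)
next
  case (Suc k)
  have "(pcompose f g ^ (p ^ k)) ^ p - pcompose f (g ^ (p ^ k)) ^ p \<in> cyc_ideal p n"
    by (rule cyc.cong_power) (rule Suc)
  from cyc.cong_trans[OF this pcompose_power_prime_cong[OF assms]]
  show ?case by (simp add: mult.commute flip: power_mult)
qed

text \<open>Makes composition compatible with congruence of the inner polynomial.\<close>

lemma diff_dvd_pcompose_diff:
  fixes f :: "'a :: comm_ring_1 poly"
  shows "g - g' dvd pcompose f g - pcompose f g'"
proof (induction f)
  case (pCons c f)
  have "pcompose (pCons c f) g - pcompose (pCons c f) g' =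
    (g - g') * pcompose f g + g' * (pcompose f g - pcompose f g')"
    by (simp add: pcompose_pCons algebra_simps)
  then show ?case using pCons.IH by simp
qed simp

text \<open>By Frobenius, \<open>(X^m - 1)^(p^r)\<close> is congruent to \<open>X^n - 1\<close>
  modulo \<open>p\<close>. So \<open>f ^ (p ^ r)\<close> lies in \<open>(p, X^n - 1)\<close>, and
  its \<open>t\<close>-th power in \<open>(p^t, X^n - 1)\<close>.\<close>

lemma nilpotent_mod_prime_power:
  assumes "prime p" "n = p ^ r * m" "f \<in> cyc_ideal p m"
  shows "f ^ (p ^ r * t) \<in> cyc_ideal (p ^ t) n"
proof -
  obtain h k where f: "f = of_nat p * h + (monom 1 m - 1) * k"
    using assms(3) by (auto simp: cyc_ideal_def)
  have "f - (monom 1 m - 1) * k \<in> cyc_ideal p n"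
    unfolding f by (simp add: of_nat_dvd_mem)
  then have 1: "f ^ (p ^ r) - ((monom 1 m - 1) * k) ^ (p ^ r) \<in> cyc_ideal p n"
    by (rule cyc.cong_power)
  \<comment> \<open>Writing \<open>X^m - 1\<close> as a composition lets Frobenius handle the sign
    for \<open>p = 2\<close> and odd \<open>p\<close> alike.\<close>
  have "pcompose [:- 1, 1:] (monom 1 m) ^ (p ^ r) - pcompose [:- 1, 1:] (monom 1 m ^ (p ^ r)) \<in> cyc_ideal p n"
    by (rule pcompose_power_cong[OF assms(1)])
  moreover have "monom (1::int) m ^ (p ^ r) = monom 1 n" by (simp add: monom_power assms(2) mult.commute)
  moreover have "pcompose [:- 1, 1:] g = g - 1" for g :: "int poly"
    by (simp add: pcompose_pCons one_pCons)
  ultimately have "(monom 1 m - 1) ^ (p ^ r) \<in> cyc_ideal p n"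
    using cyc.cong_mem monom_diff_mem_cyc_ideal by metis
  then have "((monom 1 m - 1) * k) ^ (p ^ r) \<in> cyc_ideal p n"
    unfolding power_mult_distrib by (rule cyc.mult_mem_right)
  with 1 have F: "f ^ (p ^ r) \<in> cyc_ideal p n" by (rule cyc.cong_mem)
  have "(f ^ (p ^ r)) ^ t \<in> cyc_ideal (p ^ t) n"
  proof (induction t)
    case 0
    show ?case using of_nat_mem_cyc_ideal[of 1 n] by simp
  next
    case (Suc t)
    show ?case unfolding power_Suc by (rule cyc_ideal_mult) (fact F, fact Suc)
  qed
  then show ?thesis by (simp add: power_mult)
qed

lemma card_unit_reps_prime_power:
  assumes "prime p" "n = p ^ r * m" "n > 0" "t > 0"
  shows "card (unit_reps (p ^ t) n) * p ^ m = card (unit_reps p m) * p ^ (t * n)"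
  unfolding power_mult
proof (rule card_unit_reps_lift)
  show "cyc_ideal (p ^ t) n \<subseteq> cyc_ideal p m"
    using assms by (intro cyc_ideal_mono) auto
  show "\<exists>k. f ^ k \<in> cyc_ideal (p ^ t) n" if "f \<in> cyc_ideal p m" for f
    using nilpotent_mod_prime_power[OF assms(1,2) that] by blast
qed (use assms prime_gt_0_nat in auto)

text \<open>Modulo the ideal, \<open>f(X)^(p^k)\<close> is \<open>f(X^(p^k))\<close>, and
  \<open>X^(p^k)\<close> is \<open>X\<close> because exponents count modulo
  \<open>m\<close>.\<close>

lemma power_cong_self:
  assumes "prime p" "[p ^ k = 1] (mod m)"
  shows "f ^ (p ^ k) - f \<in> cyc_ideal p m"
proof -
  have frob: "f ^ (p ^ k) - pcompose f ([:0, 1:] ^ (p ^ k)) \<in> cyc_ideal p m"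
    using pcompose_power_cong[OF assms(1), of f "[:0, 1:]"] by simp
  have mod_eq: "p ^ k mod m = 1 mod m" using assms(2) by (simp only: cong_def)
  have "monom 1 (p ^ k) - monom 1 (1 mod m) \<in> cyc_ideal p m"
    unfolding mod_eq[symmetric] by (rule monom_mod_cong)
  \<comment> \<open>For \<open>m = 1\<close> the exponent \<open>1 mod m\<close> is
    \<open>0\<close>, so this is a genuine congruence.\<close>
  moreover have "monom 1 (1 mod m) - monom 1 1 \<in> cyc_ideal p m"
    by (rule cyc.cong_sym) (rule monom_mod_cong)
  ultimately have "monom 1 (p ^ k) - monom 1 1 \<in> cyc_ideal p m" by (rule cyc.cong_trans)
  then have "[:0, 1:] ^ (p ^ k) - [:0, 1:] \<in> cyc_ideal p m"
    by (simp add: monom_altdef)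
  then have "pcompose f ([:0, 1:] ^ (p ^ k)) - pcompose f [:0, 1:] \<in> cyc_ideal p m"
    by (rule cyc.dvd_mem) (rule diff_dvd_pcompose_diff)
  from cyc.cong_trans[OF frob this] show ?thesis by simp
qed

section \<open>Prime ideals and the number of roots modulo them\<close>

locale ring_prime_ideal = ring_ideal +
  assumes one_notin: "1 \<notin> I"
    and prime_mem: "f * g \<in> I \<Longrightarrow> f \<in> I \<or> g \<in> I"
begin

lemma power_mem: "f ^ k \<in> I \<Longrightarrow> f \<in> I"
proof (induction k)
  case (Suc k)
  then show ?case using prime_mem[of f "f ^ k"] by auto
qed (simp add: one_notin)

text \<open>In the integral domain modulo \<open>I\<close>, a polynomial with more roots than its
  degree vanishes. Roots are split off one at a time by synthetic division.\<close>

lemma coeff_mem_if_roots: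
  assumes "finite A" "\<And>a b. a \<in> A \<Longrightarrow> b \<in> A \<Longrightarrow> a - b \<in> I \<Longrightarrow> a = b"
    and "\<And>a. a \<in> A \<Longrightarrow> poly F a \<in> I" and "degree F < card A"
  shows "coeff F i \<in> I"
  using assms
proof (induction A arbitrary: F i rule: finite_induct)
  case (insert a A)
  define Q where "Q = synthetic_div F a"
  have F: "F = [:- a, 1:] * Q + [:poly F a:]" unfolding Q_def by (rule synthetic_div_correct'[symmetric])
  show ?case
  \<comment> \<open>For constant \<open>F\<close> the quotient has degree \<open>0\<close> as well,
    and the degree bound for the induction would fail when \<open>A\<close> is empty.\<close>
  proof (cases "degree F = 0")
    case True
    then obtain c where "F = [:c:]" by (metis degree_eq_zeroE)
    then show ?thesis using insert.prems(2)[of a] by (cases i) (auto intro: zero_mem)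
  next
    case False
    have Q: "coeff Q j \<in> I" for j
    proof (rule insert.IH)
      show "degree Q < card A" using insert False by (simp add: Q_def degree_synthetic_div)
      show "poly Q b \<in> I" if "b \<in> A" for b
      proof -
        have "poly F b = (b - a) * poly Q b + poly F a"
          using arg_cong[OF F, of "\<lambda>G. poly G b"] by (simp add: algebra_simps)
        then have "(b - a) * poly Q b = poly F b - poly F a" by simp
        also have "\<dots> \<in> I" using insert.prems(2) that by (intro diff_mem) auto
        finally have "b - a \<in> I \<or> poly Q b \<in> I" by (rule prime_mem)
        then show ?thesis using insert that by auto
      qed
    qed (use insert in auto)
    have "coeff ([:- a, 1:] * Q) i \<in> I"
      by (cases i) (auto intro!: diff_mem mult_mem uminus_mem simp: Q)
    moreover have "coeff [:poly F a:] i \<in> I"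
      using insert.prems(2)[of a] by (cases i) (auto intro: zero_mem)
    ultimately show ?thesis
      using arg_cong[OF F, of "\<lambda>G. coeff G i"] by (simp only: coeff_add add_mem)
  qed
qed simp

definition residue :: "'a \<Rightarrow> 'a set" where
  "residue f = {g. f - g \<in> I}"

lemma residue_eq_iff: "residue f = residue g \<longleftrightarrow> f - g \<in> I"
proof
  assume "residue f = residue g"
  then show "f - g \<in> I" using zero_mem by (auto simp: residue_def set_eq_iff)
next
  assume "f - g \<in> I"
  then show "residue f = residue g" unfolding residue_def using cong_trans cong_sym by blast
qed

text \<open>The roots of \<open>X^N - X\<close> in the quotient by \<open>I\<close>. Below,
  \<open>N\<close> is a power of \<open>p\<close>, and this set stands for the field with
  \<open>N\<close> elements.\<close>

definition fixed_residues :: "nat \<Rightarrow> 'a set set" where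
  "fixed_residues N = residue ` {f. f ^ N - f \<in> I}"

text \<open>The monic polynomial \<open>X^N - X\<close> cannot have more than \<open>N\<close> roots
  modulo a prime ideal. An infinite set has \<open>card\<close> zero, so finiteness is a separate
  matter.\<close>

lemma card_fixed_residues_le:
  assumes "N > 1"
  shows "card (fixed_residues N) \<le> N"
proof (rule ccontr)
  assume "\<not> card (fixed_residues N) \<le> N"
  \<comment> \<open>\<open>A\<close> picks one element from each fixed residue.\<close>
  moreover obtain A where A: "A \<subseteq> {f. f ^ N - f \<in> I}" "inj_on residue A" "residue ` A = fixed_residues N"
    using subset_image_inj[THEN iffD1, OF subset_refl, of "{f. f ^ N - f \<in> I}" residue]
    unfolding fixed_residues_def by auto
  ultimately have cA: "card A > N" by (metis card_image not_le)
  then have fin: "finite A" using card.infinite by fastforce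
  define F where "F = monom (1::'a) N - monom 1 1"
  have "coeff F N \<in> I"
  proof (rule coeff_mem_if_roots[OF fin])
    show "a = b" if "a \<in> A" "b \<in> A" "a - b \<in> I" for a b
      using that A(2) by (auto simp: inj_on_def residue_eq_iff)
    show "poly F a \<in> I" if "a \<in> A" for a
      using that A(1) by (auto simp: F_def poly_monom)
    have "degree F \<le> N"
      unfolding F_def using degree_monom_le[of "1 :: 'a" N] degree_monom_le[of "1 :: 'a" 1] assms
      by (intro degree_diff_le) linarith+
    then show "degree F < card A" using cA by simp
  qed
  then show False using assms one_notin by (simp add: F_def coeff_monom)
qed

lemma zero_mem_fixed_residues: "N > 0 \<Longrightarrow> residue 0 \<in> fixed_residues N"
  unfolding fixed_residues_def by (intro imageI) (simp add: zero_mem zero_power)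

end

section \<open>Primitive roots of unity\<close>

lemma minus_one_power_mult_coeff:
  "coeff ((- 1) ^ k * f) i = (- 1) ^ k * coeff (f :: 'a :: comm_ring_1 poly) i"
  by (cases "even k") auto

lemma prod_monom_one: "(\<Prod>l\<in>S. monom (1 :: 'a :: comm_semiring_1) (e l)) = monom 1 (sum e S)"
  by (induction S rule: infinite_finite_induct) (auto simp: mult_monom)

text \<open>For distinct primes \<open>l\<close> dividing \<open>m\<close>, no nonempty sum of numbers \<open>m / l\<close> is a multiple of
  \<open>m\<close>, so the constant coefficient of the reduced product is \<open>\<plusminus>1\<close>.\<close>

lemma prod_monom_notin_cyc_ideal:
  assumes "prime p" "m > 0"
  shows "(\<Prod>l\<in>prime_factors m. monom 1 (m div l) - 1) \<notin> cyc_ideal p m"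
proof
  define L where "L = prime_factors m"
  define e where "e S = (\<Sum>l\<in>S. m div l)" for S
  \<comment> \<open>The product expanded over subsets of \<open>L\<close>, with exponents reduced
    modulo \<open>m\<close> so that the coefficient criterion applies.\<close>
  define r where "r = (\<Sum>S\<in>Pow L. (- 1) ^ (card L - card S) * monom (1::int) (e S mod m))"
  assume "(\<Prod>l\<in>prime_factors m. monom 1 (m div l) - 1) \<in> cyc_ideal p m"
  moreover have "(\<Prod>l\<in>prime_factors m. monom (1::int) (m div l) - 1) =
    (\<Sum>S\<in>Pow L. (- 1) ^ (card L - card S) * monom 1 (e S))"
    unfolding L_def[symmetric] e_def
    by (subst prod_diff_conv_sum') (auto simp: L_def monom_power prod_monom_one intro!: sum.cong)
  moreover have "(\<Sum>S\<in>Pow L. (- 1) ^ (card L - card S) * monom 1 (e S)) - r \<in> cyc_ideal p m"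
    unfolding r_def right_diff_distrib[symmetric]
    by (intro cyc.cong_sum) (auto simp flip: right_diff_distrib intro: cyc.mult_mem monom_mod_cong)
  ultimately have "r \<in> cyc_ideal p m"
    using cyc.cong_sym cyc.cong_mem by metis
  then have "int p dvd coeff r 0"
  proof (rule mem_cyc_ideal_coeff_dvd[OF _ \<open>m > 0\<close>])
    fix i assume "i \<ge> m"
    then have "e S mod m \<noteq> i" for S using mod_less_divisor[OF \<open>m > 0\<close>, of "e S"] by linarith
    then show "coeff r i = 0"
      by (simp add: r_def coeff_sum minus_one_power_mult_coeff coeff_monom)
  qed
  moreover have "m dvd e S \<longleftrightarrow> S = {}" if S: "S \<in> Pow L" for S
  proof
    assume dvd: "m dvd e S"
    show "S = {}"
    proof (rule ccontr)
      assume "S \<noteq> {}"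
      then obtain q where q: "q \<in> S" by blast
      have q': "prime q" "q dvd m" using q S by (auto simp: L_def)
      have fin: "finite S" using S by (auto simp: L_def intro: finite_subset)
      \<comment> \<open>The full power \<open>q ^ v\<close> of \<open>q\<close> in \<open>m\<close>
        divides each \<open>m div l\<close> with \<open>l \<noteq> q\<close>, but not
        \<open>m div q\<close>, so it cannot divide the whole sum.\<close>
      define v where "v = multiplicity q m"
      have "q ^ v dvd m" by (simp add: v_def multiplicity_dvd)
      have "q ^ v dvd m div l" if l: "l \<in> S" "l \<noteq> q" for l
      proof -
        have "prime l" "l dvd m" using l S by (auto simp: L_def)
        then have "coprime (q ^ v) l" using q' l(2) by (simp add: primes_coprime)
        then show ?thesis
          using \<open>q ^ v dvd m\<close> \<open>l dvd m\<close> by (metis coprime_dvd_mult_right_iff dvd_mult_div_cancel)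
      qed
      then have "q ^ v dvd (\<Sum>l\<in>S - {q}. m div l)" by (intro dvd_sum) auto
      moreover have "e S = m div q + (\<Sum>l\<in>S - {q}. m div l)"
        unfolding e_def using fin q by (rule sum.remove)
      ultimately have "q ^ v dvd m div q"
        using dvd \<open>q ^ v dvd m\<close> by (metis dvd_add_left_iff dvd_trans)
      then have "q ^ Suc v dvd m" using q'(2) by (metis dvd_mult_div_cancel mult_dvd_mono dvd_refl power_Suc)
      then have "Suc v \<le> multiplicity q m"
        using q'(1) \<open>m > 0\<close> by (intro multiplicity_geI) auto
      then show False by (simp add: v_def)
    qed
  qed (simp add: e_def)
  then have "coeff r 0 = (\<Sum>S\<in>Pow L. if S = {} then (- 1) ^ (card L) else 0)"
    unfolding r_def coeff_sum
    by (intro sum.cong) (auto simp: minus_one_power_mult_coeff coeff_monom mod_eq_0_iff_dvd)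
  then have "coeff r 0 = (- 1) ^ card L" by (simp add: L_def)
  ultimately have "int p dvd 1" by (cases "even (card L)") auto
  then show False using assms(1) by auto
qed

text \<open>A maximal one among the annihilators of the nonzero multiples of
  \<open>\<Prod> (X^(m/l) - 1)\<close> is a prime ideal; that product does not lie in it because
  \<open>f \<mapsto> f^q\<close> is the identity modulo \<open>(p, X^m - 1)\<close> for a suitable power \<open>q\<close> of \<open>p\<close>.\<close>

lemma ex_prime_ideal_primitive:
  assumes p: "prime p" and cop: "coprime m p" and m: "m > 0"
  shows "\<exists>M. ring_prime_ideal M \<and> cyc_ideal p m \<subseteq> M \<and> (\<forall>i. monom 1 i - 1 \<in> M \<longrightarrow> m dvd i)"
proof -
  define I where "I = cyc_ideal p m"
  define s where "s = (\<Prod>l\<in>prime_factors m. monom (1::int) (m div l) - 1)"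
  have sI: "s \<notin> I" unfolding s_def I_def by (rule prod_monom_notin_cyc_ideal[OF p m])
  define q where "q = p ^ ord m p"
  have "ord m p > 0" using cop by simp
  then have q2: "q \<ge> 2" unfolding q_def
    using prime_ge_2_nat[OF p] self_le_power[of p "ord m p"] by linarith
  have fq: "f ^ q - f \<in> I" for f
    unfolding q_def I_def by (rule power_cong_self[OF p]) (rule ord)
  \<comment> \<open>Size of the annihilator of \<open>u\<close> in the finite quotient; being
    bounded by \<open>p ^ m\<close>, it attains a maximum.\<close>
  define \<mu> where "\<mu> u = card {f \<in> reps p m. f * u \<in> I}" for u
  have "\<mu> u \<le> p ^ m" for u
    unfolding \<mu>_def card_reps[symmetric] by (intro card_mono finite_reps) auto
  then obtain u where u: "u \<notin> I" "s dvd u"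
    and max: "\<And>v. v \<notin> I \<Longrightarrow> s dvd v \<Longrightarrow> \<mu> v \<le> \<mu> u"
    using ex_has_greatest_nat[of "\<lambda>u. u \<notin> I \<and> s dvd u" s \<mu> "Suc (p ^ m)"] sI by (auto simp: less_Suc_eq_le)
  define M where "M = {f. f * u \<in> I}"
  interpret I: ring_ideal I unfolding I_def by (rule cyc.ring_ideal_axioms)
  interpret M: ring_prime_ideal M
  proof
    show "f \<in> M \<or> g \<in> M" if fg: "f * g \<in> M" for f g
    proof (rule disjCI)
      assume "g \<notin> M"
      then have "\<mu> (g * u) \<le> \<mu> u" using u by (intro max) (auto simp: M_def)
      moreover have "{f \<in> reps p m. f * u \<in> I} \<subseteq> {f \<in> reps p m. f * (g * u) \<in> I}"
        using I.mult_mem[of "_ * u" g] by (auto simp: mult.left_commute)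
      \<comment> \<open>Here \<open>g * u\<close> is again a nonzero multiple of \<open>s\<close>,
        so maximality forces its annihilator to equal that of \<open>u\<close>.\<close>
      ultimately have eq: "{f \<in> reps p m. f * u \<in> I} = {f \<in> reps p m. f * (g * u) \<in> I}"
        unfolding \<mu>_def by (intro card_seteq) (auto simp: finite_reps)
      define f' where "f' = reduce p m f"
      have f': "f' \<in> reps p m" "f - f' \<in> I"
        unfolding f'_def I_def using reduce[of p m f] m prime_gt_0_nat[OF p] by auto
      have red: "f * v - f' * v \<in> I" for v
        using I.mult_mem_right[OF f'(2), of v] by (simp add: left_diff_distrib)
      have "f * (g * u) \<in> I" using fg by (simp add: M_def mult.assoc)
      then have "f' * (g * u) \<in> I" using red I.cong_sym I.cong_mem by blast
      then have "f' * u \<in> I" using f' eq by blast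
      then show "f \<in> M" using red I.cong_mem by (auto simp: M_def)
    qed
  qed (use u in \<open>auto simp: M_def mult.assoc distrib_right intro: I.zero_mem I.add_mem I.mult_mem\<close>)
  have IM: "I \<subseteq> M" by (auto simp: M_def intro: I.mult_mem_right)
  have sM: "s \<notin> M"
  proof
    assume "s \<in> M"
    then have "s * u \<in> I" by (simp add: M_def)
    obtain g where g: "u = s * g" using u(2) by auto
    \<comment> \<open>With \<open>u = s * g\<close> this is \<open>s ^ q * g\<close>, which is
      congruent to \<open>s * g = u\<close>.\<close>
    have "s ^ (q - 2) * (s * u) \<in> I" by (rule I.mult_mem) fact
    moreover have "s ^ (q - 2) * (s * u) = s ^ Suc (Suc (q - 2)) * g" by (simp add: g mult_ac)
    moreover have "Suc (Suc (q - 2)) = q" using q2 by simp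
    ultimately have "s ^ q * g \<in> I" by simp
    moreover have "s ^ q * g - s * g \<in> I"
      using I.mult_mem_right[OF fq[of s], of g] by (simp add: left_diff_distrib)
    ultimately have "u \<in> I" unfolding g using I.cong_sym I.cong_mem by blast
    then show False using u by blast
  qed
  have "m dvd i" if i: "monom 1 i - 1 \<in> M" for i
  proof (rule ccontr)
    assume "\<not> m dvd i"
    then have "i \<noteq> 0" by (metis dvd_0_right)
    \<comment> \<open>From \<open>X^i\<close> and \<open>X^m\<close> being \<open>1\<close> modulo
      \<open>M\<close>, Bezout gives the same for \<open>X^(gcd i m)\<close>.\<close>
    then obtain x y where xy: "i * x = m * y + gcd i m" using bezout_nat by blast
    have pow: "monom 1 (j * z) - 1 \<in> M" if "monom 1 j - 1 \<in> M" for j z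
      using M.cong_power[OF that, of z] by (simp add: monom_power mult.commute)
    have "monom 1 m - 1 \<in> M" using IM monom_diff_mem_cyc_ideal I_def by blast
    then have "(monom 1 (m * y) - 1) * monom 1 (gcd i m) \<in> M"
      by (intro M.mult_mem_right pow)
    then have "monom 1 (i * x) - monom 1 (gcd i m) \<in> M"
      by (simp add: xy mult_monom left_diff_distrib)
    then have g: "monom 1 (gcd i m) - 1 \<in> M"
      using pow[OF i, of x] M.cong_trans M.cong_sym by blast
    define d where "d = m div gcd i m"
    have d: "m = gcd i m * d" by (simp add: d_def)
    have "d \<noteq> 1" using d \<open>\<not> m dvd i\<close> by (metis gcd_dvd1 mult.right_neutral)
    \<comment> \<open>Since \<open>l\<close> divides \<open>m div gcd i m\<close>, the number
      \<open>m div l\<close> is a multiple of \<open>gcd i m\<close>; so a factor of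
      \<open>s\<close> would lie in \<open>M\<close>.\<close>
    then obtain l c where l: "prime l" "d = l * c" using prime_factor_nat by (metis dvdE)
    have "m = l * (gcd i m * c)" using d l by (metis mult.left_commute)
    then have "m div l = gcd i m * c" using prime_gt_0_nat[OF l(1)]
      by (metis nonzero_mult_div_cancel_left less_numeral_extra(3))
    moreover have "l dvd m" using \<open>m = l * (gcd i m * c)\<close> by (rule dvdI)
    then have "l \<in> prime_factors m" using l(1) m by (simp add: prime_factors_dvd)
    ultimately have "monom 1 (m div l) - 1 \<in> M" "monom 1 (m div l) - 1 dvd s"
      using pow[OF g, of c] by (auto simp: s_def intro: dvd_prodI)
    then have "s \<in> M" by (rule M.dvd_mem)
    with sM show False ..
  qed
  then show ?thesis using M.ring_prime_ideal_axioms IM I_def by blast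
qed

section \<open>Orbits of multiplication by a prime\<close>

text \<open>The cyclotomic coset of \<open>j\<close> modulo \<open>m\<close> with respect to
  \<open>p\<close>.\<close>

definition mult_orbit :: "nat \<Rightarrow> nat \<Rightarrow> nat \<Rightarrow> nat set" where
  "mult_orbit m p j = {j * p ^ i mod m | i. True}"

definition orbit_reps :: "nat \<Rightarrow> nat \<Rightarrow> nat set" where
  "orbit_reps m p = {j. j < m \<and> Min (mult_orbit m p j) = j}"

lemma finite_orbit_reps: "finite (orbit_reps m p)"
  by (rule finite_subset[of _ "{..<m}"]) (auto simp: orbit_reps_def)

lemma mult_orbit_subset: "m > 0 \<Longrightarrow> mult_orbit m p j \<subseteq> {..<m}"
  by (auto simp: mult_orbit_def)

lemma mem_mult_orbit_self: "j < m \<Longrightarrow> j \<in> mult_orbit m p j"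
  unfolding mult_orbit_def by (auto intro!: exI[of _ 0])

lemma mult_orbit_mono:
  assumes "k \<in> mult_orbit m p j"
  shows "mult_orbit m p k \<subseteq> mult_orbit m p j"
proof
  fix x assume "x \<in> mult_orbit m p k"
  then obtain i i' where "x = k * p ^ i mod m" "k = j * p ^ i' mod m"
    using assms by (auto simp: mult_orbit_def)
  then have "x = j * p ^ (i' + i) mod m" by (simp add: mod_mult_left_eq power_add mult.assoc)
  then show "x \<in> mult_orbit m p j" by (auto simp: mult_orbit_def)
qed

text \<open>Multiplication by \<open>p\<close> is invertible modulo \<open>m\<close>: as
  \<open>p ^ q\<close> is \<open>1\<close>, a factor \<open>p ^ i\<close> is undone by
  \<open>p ^ (i * q - i)\<close>.\<close>

lemma mult_orbit_eq:
  assumes cop: "coprime m p" and j: "j < m" and k: "k \<in> mult_orbit m p j"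
  shows "mult_orbit m p k = mult_orbit m p j"
proof (intro equalityI mult_orbit_mono k)
  obtain i where i: "k = j * p ^ i mod m" using k by (auto simp: mult_orbit_def)
  define q where "q = ord m p"
  have "q > 0" using cop by (simp add: q_def)
  have "[k * p ^ (i * q - i) = j * p ^ i * p ^ (i * q - i)] (mod m)"
    unfolding i by (simp add: cong_def mod_mult_left_eq)
  moreover have "p ^ i * p ^ (i * q - i) = (p ^ q) ^ i"
    using \<open>q > 0\<close> by (simp add: mult.commute flip: power_add power_mult)
  moreover have "[j * (p ^ q) ^ i = j * 1 ^ i] (mod m)"
    unfolding q_def by (intro cong_scalar_left cong_pow ord)
  ultimately have "[k * p ^ (i * q - i) = j] (mod m)" by (metis cong_trans mult.assoc mult_1_right power_one)
  then have "k * p ^ (i * q - i) mod m = j" using j by (simp add: cong_def)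
  then show "j \<in> mult_orbit m p k" by (auto simp: mult_orbit_def)
qed

lemma orbit_reps_eq:
  assumes "coprime m p" "j \<in> orbit_reps m p" "j' \<in> orbit_reps m p"
    and "k \<in> mult_orbit m p j" "k \<in> mult_orbit m p j'"
  shows "j = j'"
proof -
  have "j < m" "j' < m" using assms(2,3) by (simp_all add: orbit_reps_def)
  then have "mult_orbit m p j = mult_orbit m p j'"
    using mult_orbit_eq[OF assms(1) _ assms(4)] mult_orbit_eq[OF assms(1) _ assms(5)] by blast
  then show ?thesis using assms(2,3) unfolding orbit_reps_def mem_Collect_eq by metis
qed

lemma ex_orbit_rep:
  assumes "coprime m p" "k < m"
  shows "\<exists>j\<in>orbit_reps m p. k \<in> mult_orbit m p j"
proof -
  define j where "j = Min (mult_orbit m p k)"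
  have "finite (mult_orbit m p k)"
    using assms by (intro finite_subset[OF mult_orbit_subset]) auto
  then have j: "j \<in> mult_orbit m p k"
    unfolding j_def using mem_mult_orbit_self[OF assms(2)] by (intro Min_in) auto
  have eq: "mult_orbit m p j = mult_orbit m p k" by (rule mult_orbit_eq[OF assms j])
  have "j < m" using j assms mult_orbit_subset[of m p k] by auto
  then have "j \<in> orbit_reps m p" using eq by (simp add: orbit_reps_def j_def)
  moreover have "k \<in> mult_orbit m p j" using eq mem_mult_orbit_self[OF assms(2)] by simp
  ultimately show ?thesis by blast
qed

text \<open>Dividing by \<open>g = gcd j m\<close> and cancelling the coprime part of
  \<open>j\<close> leaves \<open>p ^ i\<close> congruent to \<open>1\<close> modulo
  \<open>m div g\<close>. Hence the order there is the length of the orbit of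
  \<open>j\<close>.\<close>

lemma mult_power_cong_iff:
  fixes m :: nat
  assumes "m > 0"
  shows "[j * p ^ i = j] (mod m) \<longleftrightarrow> ord (m div gcd j m) p dvd i"
proof -
  define g where "g = gcd j m"
  have "g > 0" using assms by (simp add: g_def)
  define j' d where "j' = j div g" and "d = m div g"
  have jm: "j = g * j'" "m = g * d" by (simp_all add: j'_def d_def g_def)
  have "coprime j' d" unfolding j'_def d_def g_def using assms by (intro div_gcd_coprime) simp
  have "[j * p ^ i = j] (mod m) \<longleftrightarrow> [g * (j' * p ^ i) = g * (j' * 1)] (mod g * d)"
    by (simp add: jm mult.assoc)
  also have "\<dots> \<longleftrightarrow> [j' * p ^ i = j' * 1] (mod d)"
    using \<open>g > 0\<close> by (simp only: cong_def mult_mod_right[symmetric]) simp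
  also have "\<dots> \<longleftrightarrow> [p ^ i = 1] (mod d)"
    using \<open>coprime j' d\<close> by (rule cong_mult_lcancel_nat)
  finally show ?thesis by (simp only: ord_divides d_def g_def)
qed

lemma card_residues_gcd:
  assumes "m > 0" "d dvd m"
  shows "card {j. j < m \<and> m div gcd j m = d} = totient d"
proof -
  have d: "m div (m div d) = d" "m div d dvd m" using assms by auto
  have iff: "m div gcd j m = d \<longleftrightarrow> gcd j m = m div d" for j
    using assms by (metis d(1) gcd_dvd2 dvd_div_eq_iff div_div_eq_right nonzero_mult_div_cancel_left
        dvd_mult_div_cancel gcd_nat.extremum_uniqueI mult.commute not_gr0)
  \<comment> \<open>Residues start at \<open>0\<close>, whereas the gcd count for
    \<open>totient\<close> ranges over \<open>{0<..m}\<close>; so \<open>0\<close> is exchanged for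
    \<open>m\<close>.\<close>
  have "bij_betw (\<lambda>j. if j = 0 then m else j) {j. j < m \<and> gcd j m = m div d} {k\<in>{0<..m}. gcd k m = m div d}"
    by (rule bij_betwI[where g = "\<lambda>k. if k = m then 0 else k"]) (use \<open>m > 0\<close> in auto)
  then show ?thesis
    using card_gcd_eq_totient[OF assms(1) d(2)] by (simp add: iff d bij_betw_same_card)
qed

lemma ord_pos_if_dvd:
  assumes "coprime m p" "d dvd m"
  shows "ord d (p :: nat) > 0"
proof -
  have "coprime d p" using coprime_divisors[OF assms(2) dvd_refl assms(1)] .
  then show ?thesis by simp
qed

text \<open>The \<open>totient d\<close> residues belonging to \<open>d\<close> split into orbits of
  length \<open>ord d p\<close>, so pairs of a representative and an exponent enumerate them without
  repetition.\<close>

lemma card_orbit_reps_class: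
  assumes cop: "coprime m p" and m: "m > 0" and d: "d dvd m"
  shows "card {j \<in> orbit_reps m p. m div gcd j m = d} * ord d p = totient d"
proof -
  define T where "T = {j \<in> orbit_reps m p. m div gcd j m = d}"
  define C where "C = {j. j < m \<and> m div gcd j m = d}"
  have o: "ord d p > 0" by (rule ord_pos_if_dvd[OF cop d])
  \<comment> \<open>The divisor \<open>d\<close> is constant along an orbit.\<close>
  have gcd: "gcd (j * p ^ i mod m) m = gcd j m" for j i
  proof -
    have "coprime m (p ^ i)" using cop by simp
    then have "gcd m (j * p ^ i) = gcd m j" by (rule gcd_mult_right_right_cancel)
    then show ?thesis by (metis gcd_red_nat gcd.commute)
  qed
  have "bij_betw (\<lambda>(j, i). j * p ^ i mod m) (T \<times> {..<ord d p}) C"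
  proof (rule bij_betw_imageI)
    have le: "i = i'" if "[j * p ^ i = j * p ^ i'] (mod m)" "j \<in> T" "i' < ord d p" "i \<le> i'" for i i' j
    proof -
      have "[p ^ i * (j * p ^ (i' - i)) = p ^ i * j] (mod m)"
        using that(1) \<open>i \<le> i'\<close> by (simp add: mult_ac cong_sym_eq flip: power_add)
      then have "[j * p ^ (i' - i) = j] (mod m)"
        using cop by (subst (asm) cong_mult_lcancel_nat) (auto simp: coprime_commute)
      then have "ord d p dvd i' - i"
        using mult_power_cong_iff[OF m] \<open>j \<in> T\<close> by (auto simp: T_def)
      then show ?thesis using that by (auto dest: dvd_imp_le)
    qed
    show "inj_on (\<lambda>(j, i). j * p ^ i mod m) (T \<times> {..<ord d p})"
    proof (rule inj_onI)
      fix x y assume xy: "x \<in> T \<times> {..<ord d p}" "y \<in> T \<times> {..<ord d p}"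
        "(case x of (j, i) \<Rightarrow> j * p ^ i mod m) = (case y of (j, i) \<Rightarrow> j * p ^ i mod m)"
      obtain j i j' i' where eq: "x = (j, i)" "y = (j', i')" by (cases x, cases y) blast
      have *: "j \<in> T" "j' \<in> T" "i \<in> {..<ord d p}" "i' \<in> {..<ord d p}"
        "j * p ^ i mod m = j' * p ^ i' mod m"
        using xy by (auto simp: eq)
      have "j = j'"
        by (rule orbit_reps_eq[OF cop, of _ _ "j * p ^ i mod m"])
          (use * in \<open>auto simp: T_def mult_orbit_def intro: exI[of _ i] exI[of _ i']\<close>)
      moreover have "i = i'"
      proof (cases "i \<le> i'")
        case True
        then show ?thesis using le[of j i i'] * \<open>j = j'\<close> by (simp add: cong_def)
      next
        case False
        then show ?thesis using le[of j i' i] * \<open>j = j'\<close> by (simp add: cong_def)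
      qed
      ultimately show "x = y" by (simp add: eq)
    qed
    show "(\<lambda>(j, i). j * p ^ i mod m) ` (T \<times> {..<ord d p}) = C"
    proof (rule equalityI; rule subsetI)
      fix k assume "k \<in> (\<lambda>(j, i). j * p ^ i mod m) ` (T \<times> {..<ord d p})"
      then show "k \<in> C" using m by (auto simp: C_def T_def gcd)
    next
      fix k assume k: "k \<in> C"
      then obtain j where j: "j \<in> orbit_reps m p" "k \<in> mult_orbit m p j"
        using ex_orbit_rep[OF cop, of k] by (auto simp: C_def)
      then obtain i where i: "k = j * p ^ i mod m" by (auto simp: mult_orbit_def)
      then have jT: "j \<in> T" using j k by (auto simp: T_def C_def gcd)
      define i' where "i' = i mod ord d p"
      have "[j * p ^ (ord d p * (i div ord d p)) = j] (mod m)"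
        using jT by (subst mult_power_cong_iff[OF m]) (auto simp: T_def)
      then have "[j * p ^ (ord d p * (i div ord d p)) * p ^ i' = j * p ^ i'] (mod m)"
        by (rule cong_scalar_right)
      then have "k = j * p ^ i' mod m"
        unfolding i i'_def cong_def by (simp add: mult.assoc flip: power_add)
      moreover have "i' < ord d p" using o by (simp add: i'_def)
      ultimately show "k \<in> (\<lambda>(j, i). j * p ^ i mod m) ` (T \<times> {..<ord d p})" using jT by force
    qed
  qed
  from bij_betw_same_card[OF this] show ?thesis
    using card_residues_gcd[OF m d] by (simp add: card_cartesian_product T_def C_def)
qed

lemma orbit_reps_group:
  assumes "m > 0"
  shows "(\<Sum>j\<in>orbit_reps m p. f (m div gcd j m)) =
      (\<Sum>d | d dvd m. card {j \<in> orbit_reps m p. m div gcd j m = d} * f d)"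
    and "(\<Prod>j\<in>orbit_reps m p. f (m div gcd j m)) =
      (\<Prod>d | d dvd m. f d ^ card {j \<in> orbit_reps m p. m div gcd j m = d})"
proof -
  have im: "(\<lambda>j. m div gcd j m) ` orbit_reps m p \<subseteq> {d. d dvd m}"
    using assms by (auto intro: div_dvd_iff_mult[THEN iffD2])
  have fin: "finite {d. d dvd m}" using assms by simp
  show "(\<Sum>j\<in>orbit_reps m p. f (m div gcd j m)) =
      (\<Sum>d | d dvd m. card {j \<in> orbit_reps m p. m div gcd j m = d} * f d)"
    by (subst sum.group[OF finite_orbit_reps fin im, symmetric]) (auto intro!: sum.cong)
  show "(\<Prod>j\<in>orbit_reps m p. f (m div gcd j m)) =
      (\<Prod>d | d dvd m. f d ^ card {j \<in> orbit_reps m p. m div gcd j m = d})"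
    by (subst prod.group[OF finite_orbit_reps fin im, symmetric]) (auto intro!: prod.cong)
qed

text \<open>The orbit lengths add up to the number of residues, through the divisor sum of
  \<open>totient\<close>. This makes source and target of the Fourier transform equally
  large.\<close>

lemma sum_ord_orbit_reps:
  assumes "coprime m p" "m > 0"
  shows "(\<Sum>j\<in>orbit_reps m p. ord (m div gcd j m) p) = m"
proof -
  have "(\<Sum>j\<in>orbit_reps m p. ord (m div gcd j m) p) =
      (\<Sum>d | d dvd m. card {j \<in> orbit_reps m p. m div gcd j m = d} * ord d p)"
    by (rule orbit_reps_group(1)[OF assms(2)])
  also have "\<dots> = (\<Sum>d | d dvd m. totient d)"
    using assms by (intro sum.cong refl card_orbit_reps_class) auto
  finally show ?thesis by (simp add: totient_divisor_sum)
qed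

section \<open>The Fourier transform\<close>

text \<open>A single strictly smaller factor would make the product strictly smaller.\<close>

lemma prod_eq_imp_eq_nat:
  fixes f g :: "'a \<Rightarrow> nat"
  assumes "finite S" "\<And>j. j \<in> S \<Longrightarrow> f j \<le> g j" "\<And>j. j \<in> S \<Longrightarrow> g j > 0"
    and "prod g S \<le> prod f S" and "j \<in> S"
  shows "f j = g j"
proof (rule ccontr)
  assume "f j \<noteq> g j"
  then have "f j < g j" using assms(2,5) by (simp add: order.strict_iff_order)
  have "prod f S = f j * prod f (S - {j})" using assms(1,5) by (rule prod.remove)
  also have "\<dots> \<le> f j * prod g (S - {j})"
    using assms(2) by (intro mult_left_mono prod_mono) auto
  also have "\<dots> < g j * prod g (S - {j})"
    using \<open>f j < g j\<close> assms(3) by (intro mult_strict_right_mono prod_pos) auto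
  also have "\<dots> = prod g S" using assms(1,5) by (rule prod.remove[symmetric])
  finally show False using assms(4) by simp
qed

text \<open>Modulo \<open>M\<close> the ring is an integral domain of characteristic
  \<open>p\<close> in which \<open>X\<close> is a primitive \<open>m\<close>-th root of
  unity.\<close>

locale primitive_root_ideal = ring_prime_ideal M for M :: "int poly set" +
  fixes p m :: nat
  assumes p: "prime p" and m: "m > 0" and cop: "coprime m p"
    and le: "cyc_ideal p m \<subseteq> M"
    and primitive: "monom 1 i - 1 \<in> M \<Longrightarrow> m dvd i"
begin

text \<open>An integer in \<open>M\<close> prime to \<open>p\<close> would, by Bezout, put
  \<open>1\<close> into \<open>M\<close>.\<close>

lemma const_mem: "[:c:] \<in> M \<Longrightarrow> int p dvd c"
proof (rule ccontr)
  assume c: "[:c:] \<in> M" and "\<not> int p dvd c"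
  then have "coprime (int p) c" using p by (intro prime_imp_coprime) auto
  then obtain u v where "u * int p + v * c = 1" using bezout_int[of "int p" c] by auto
  then have "int p * u + c * v = 1" by (simp add: mult.commute)
  then have "[:1:] = [:u:] * of_nat p + [:v:] * [:c:]" by (simp add: of_nat_poly)
  also have "\<dots> \<in> M"
    using le of_nat_mem_cyc_ideal[of p m] c by (intro add_mem mult_mem) auto
  finally show False using one_notin by (simp add: one_pCons)
qed

text \<open>\<open>X\<close> is a unit modulo \<open>M\<close>, since \<open>X^m\<close> is
  \<open>1\<close> there.\<close>

lemma monom_notin: "monom 1 i \<notin> M"
proof
  assume "monom 1 i \<in> M"
  then have "monom 1 (i * (m - 1)) * monom 1 i \<in> M" by (rule mult_mem)
  moreover have "i * (m - 1) + i = m * i" using m by (cases m) auto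
  ultimately have "monom 1 (m * i) \<in> M" by (simp add: mult_monom)
  moreover have "monom 1 (m * i) - monom 1 0 \<in> M"
    using monom_mod_cong[of 1 "m * i" m p] le by auto
  ultimately have "monom 1 (m * i) - (monom 1 (m * i) - monom 1 0) \<in> M" by (rule diff_mem)
  then show False using one_notin by (simp add: one_pCons monom_0)
qed

lemma monom_diff_mem:
  assumes "i < m" "j < m" "monom 1 i - monom 1 j \<in> M"
  shows "i = j"
proof -
  have le: "i = j" if "i \<le> j" "j < m" "monom 1 j - monom 1 i \<in> M" for i j
  proof -
    have "monom 1 i * (monom 1 (j - i) - 1) = monom (1::int) j - monom 1 i"
      using that(1) by (simp add: right_diff_distrib mult_monom)
    then have "monom 1 (j - i) - 1 \<in> M"
      using that(3) prime_mem[of "monom 1 i" "monom 1 (j - i) - 1"] monom_notin by auto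
    then have "m dvd j - i" by (rule primitive)
    then show ?thesis using that(1,2) by (auto dest: dvd_imp_le)
  qed
  show ?thesis using le[of i j] le[of j i] assms cong_sym by (cases "i \<le> j") auto
qed

text \<open>Modulo \<open>M\<close>, the value of \<open>f\<close> at the \<open>j\<close>-th power of the primitive root of unity \<open>X\<close>.\<close>

definition ev :: "int poly \<Rightarrow> nat \<Rightarrow> int poly" where
  "ev f j = pcompose f (monom 1 j)"

lemma ev_mult: "ev (f * g) j = ev f j * ev g j"
  by (simp add: ev_def pcompose_mult)

lemma ev_diff: "ev (f - g) j = ev f j - ev g j"
  by (simp add: ev_def pcompose_diff)

lemma ev_one: "ev 1 j = 1"
  by (simp add: ev_def pcompose_1)

lemma ev_mod: "ev f j - ev f (j mod m) \<in> M"
  unfolding ev_def using diff_dvd_pcompose_diff monom_mod_cong[of 1 j m p] le dvd_mem by blast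

text \<open>Frobenius moves a value along the orbit of \<open>j\<close>, so one value per orbit
  determines the others.\<close>

lemma ev_power: "ev f j ^ (p ^ i) - ev f (j * p ^ i) \<in> M"
proof -
  have "pcompose f (monom 1 j) ^ (p ^ i) - pcompose f (monom 1 j ^ (p ^ i)) \<in> cyc_ideal p m"
    by (rule pcompose_power_cong[OF p])
  then show ?thesis using le by (auto simp: ev_def monom_power)
qed

lemma ev_power_mod: "ev f j ^ (p ^ i) - ev f (j * p ^ i mod m) \<in> M"
  by (rule cong_trans[OF ev_power ev_mod])

text \<open>Modulo \<open>M\<close>, each \<open>X^j\<close> is a root of \<open>X^m - 1\<close>,
  and \<open>p\<close> vanishes.\<close>

lemma ev_mem:
  assumes "f \<in> cyc_ideal p m"
  shows "ev f j \<in> M"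
proof -
  obtain h k where f: "f = of_nat p * h + (monom 1 m - 1) * k"
    using assms by (auto simp: cyc_ideal_def)
  have "ev (of_nat p) j = of_nat p" by (simp add: ev_def of_nat_poly)
  then have 1: "ev (of_nat p) j \<in> M" using le of_nat_mem_cyc_ideal by auto
  have "ev (monom 1 i) j = monom 1 (i * j)" for i
    by (induction i) (simp_all add: ev_def monom_0 pcompose_1 monom_Suc pcompose_pCons mult_monom flip: one_pCons)
  then have "ev (monom 1 m - 1) j = monom 1 (m * j) - monom 1 0"
    by (simp add: ev_diff ev_one flip: monom_eq_1)
  then have 2: "ev (monom 1 m - 1) j \<in> M" using monom_mod_cong[of 1 "m * j" m p] le by auto
  have "ev f j = ev (of_nat p) j * ev h j + ev (monom 1 m - 1) j * ev k j"
    by (simp add: f ev_def pcompose_add pcompose_mult)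
  then show ?thesis using 1 2 by (auto intro: add_mem mult_mem_right)
qed

text \<open>Read as a polynomial \<open>F\<close> with constant coefficients in
  \<open>int poly\<close>, \<open>f\<close> has the \<open>m\<close> incongruent roots
  \<open>X^j\<close> but degree below \<open>m\<close>. So its coefficients lie in \<open>M\<close>,
  hence are multiples of \<open>p\<close>.\<close>

lemma mem_if_ev:
  assumes deg: "\<And>i. i \<ge> m \<Longrightarrow> coeff f i = 0" and ev: "\<And>j. j < m \<Longrightarrow> ev f j \<in> M"
  shows "f \<in> cyc_ideal p m"
proof (rule of_nat_dvd_mem, unfold of_nat_dvd_iff_coeff, rule allI)
  fix i
  define F where "F = map_poly (\<lambda>c. [:c:]) f"
  define A where "A = (\<lambda>j. monom (1::int) j) ` {..<m}"
  have inj: "inj_on (\<lambda>j. monom (1::int) j) {..<m}"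
    by (auto simp: inj_on_def monom_eq_iff')
  have "coeff F i \<in> M"
  proof (rule coeff_mem_if_roots[of A])
    show "finite A" by (simp add: A_def)
    show "a = b" if "a \<in> A" "b \<in> A" "a - b \<in> M" for a b
      using that monom_diff_mem by (auto simp: A_def)
    show "poly F a \<in> M" if "a \<in> A" for a
      using that ev by (auto simp: A_def F_def ev_def pcompose_altdef)
    have "degree f < m" using deg m
      by (metis degree_0 le_degree leading_coeff_0_iff not_less)
    moreover have "degree F \<le> degree f"
      by (intro degree_le) (auto simp: F_def coeff_map_poly coeff_eq_0)
    ultimately show "degree F < card A" using card_image[OF inj] by (simp add: A_def)
  qed
  then show "int p dvd coeff f i" using const_mem by (simp add: F_def coeff_map_poly)
qed

lemma reps_eq_if_ev:
  assumes "f \<in> reps p m" "g \<in> reps p m" "\<And>j. j < m \<Longrightarrow> ev f j - ev g j \<in> M"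
  shows "f = g"
proof (rule reps_cong_eq[OF assms(1,2) _ m])
  show "f - g \<in> cyc_ideal p m"
    using assms by (intro mem_if_ev) (auto simp: reps_def ev_diff)
qed

lemma finite_fixed_residues: "finite (fixed_residues N)"
proof (rule finite_subset)
  show "fixed_residues N \<subseteq> residue ` reps p m"
  proof
    fix R assume "R \<in> fixed_residues N"
    then obtain f where R: "R = residue f" by (auto simp: fixed_residues_def)
    have "f - reduce p m f \<in> M" "reduce p m f \<in> reps p m"
      using reduce[of p m f] m prime_gt_0_nat[OF p] le by auto
    then show "R \<in> residue ` reps p m" unfolding R by (metis imageI residue_eq_iff)
  qed
qed (simp add: finite_reps)

text \<open>The size of the field generated over the prime field by \<open>X^j\<close>, a root of
  unity of order \<open>m div gcd j m\<close>.\<close>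

abbreviation field_size :: "nat \<Rightarrow> nat" where
  "field_size j \<equiv> p ^ ord (m div gcd j m) p"

lemma field_size_gt_1: "field_size j > 1"
proof -
  have "m div gcd j m dvd m" by (metis dvd_mult_div_cancel dvd_triv_right gcd_dvd2)
  then have "ord (m div gcd j m) p > 0" by (rule ord_pos_if_dvd[OF cop])
  with prime_gt_1_nat[OF p] show ?thesis by (rule one_less_power)
qed

lemma ev_power_field_size: "ev f j ^ field_size j - ev f j \<in> M"
proof -
  have "[j * field_size j = j] (mod m)" by (subst mult_power_cong_iff[OF m]) simp
  then have "j * field_size j mod m = j mod m" by (simp add: cong_def)
  then have "ev f j ^ field_size j - ev f (j mod m) \<in> M" using ev_power_mod by metis
  then show ?thesis using ev_mod cong_sym cong_trans by blast
qed

definition dft :: "int poly \<Rightarrow> nat \<Rightarrow> int poly set" where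
  "dft f = (\<lambda>j\<in>orbit_reps m p. residue (ev f j))"

lemma ev_orbit:
  assumes "k \<in> mult_orbit m p j"
  obtains i where "\<And>f. ev f j ^ (p ^ i) - ev f k \<in> M"
proof -
  obtain i where "k = j * p ^ i mod m" using assms by (auto simp: mult_orbit_def)
  then show thesis using that[of i] ev_power_mod by simp
qed

text \<open>Agreement at an orbit representative spreads by Frobenius to its orbit, hence to all
  \<open>m\<close> powers of \<open>X\<close>.\<close>

lemma inj_on_dft: "inj_on dft (reps p m)"
proof (rule inj_onI)
  fix f g assume f: "f \<in> reps p m" and g: "g \<in> reps p m" and eq: "dft f = dft g"
  show "f = g"
  proof (rule reps_eq_if_ev[OF f g])
    fix k assume "k < m"
    then obtain j where j: "j \<in> orbit_reps m p" "k \<in> mult_orbit m p j"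
      using ex_orbit_rep[OF cop] by blast
    obtain i where i: "\<And>f. ev f j ^ (p ^ i) - ev f k \<in> M" using ev_orbit[OF j(2)] by blast
    have "residue (ev f j) = residue (ev g j)"
      using fun_cong[OF eq, of j] j(1) by (simp add: dft_def)
    then have "ev f j - ev g j \<in> M" by (simp add: residue_eq_iff)
    then have "ev f j ^ (p ^ i) - ev g j ^ (p ^ i) \<in> M" by (rule cong_power)
    from cong_trans[OF cong_trans[OF cong_sym[OF i] this] i] show "ev f k - ev g k \<in> M" .
  qed
qed

lemma prod_field_size: "(\<Prod>j\<in>orbit_reps m p. field_size j) = p ^ m"
  by (simp only: power_sum[symmetric] sum_ord_orbit_reps[OF cop m])

text \<open>The transform is injective into a product of sets whose sizes are bounded by counting roots;
  as the product of these bounds is \<open>p^m\<close>, all bounds are attained and the transform is onto.\<close>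

lemma dft_image: "dft ` reps p m = PiE (orbit_reps m p) (\<lambda>j. fixed_residues (field_size j))"
  and card_fixed_residues: "j \<in> orbit_reps m p \<Longrightarrow> card (fixed_residues (field_size j)) = field_size j"
proof -
  let ?P = "PiE (orbit_reps m p) (\<lambda>j. fixed_residues (field_size j))"
  have sub: "dft ` reps p m \<subseteq> ?P"
    using ev_power_field_size by (auto simp: dft_def fixed_residues_def)
  have fin: "finite ?P" by (intro finite_PiE finite_orbit_reps finite_fixed_residues)
  have card_P: "card ?P = (\<Prod>j\<in>orbit_reps m p. card (fixed_residues (field_size j)))"
    by (rule card_PiE) (rule finite_orbit_reps)
  have le: "card (fixed_residues (field_size j)) \<le> field_size j" for j
    by (rule card_fixed_residues_le) (rule field_size_gt_1)
  have "p ^ m = card (dft ` reps p m)" by (simp add: card_image[OF inj_on_dft] card_reps)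
  also have "\<dots> \<le> card ?P" by (rule card_mono[OF fin sub])
  finally have ge: "p ^ m \<le> card ?P" .
  moreover have "card ?P \<le> p ^ m"
    unfolding card_P prod_field_size[symmetric] by (intro prod_mono) (use le in auto)
  ultimately show "dft ` reps p m = ?P"
    using fin sub by (intro card_subset_eq) (auto simp: card_image[OF inj_on_dft] card_reps)
  show "card (fixed_residues (field_size j)) = field_size j" if "j \<in> orbit_reps m p"
  proof (rule prod_eq_imp_eq_nat[OF finite_orbit_reps _ _ _ that])
    show "field_size j > 0" for j using field_size_gt_1[of j] by linarith
    show "prod field_size (orbit_reps m p) \<le> (\<Prod>j\<in>orbit_reps m p. card (fixed_residues (field_size j)))"
      using ge by (simp only: card_P prod_field_size)
  qed (rule le)
qed

text \<open>Values of a unit are invertible modulo \<open>M\<close>. Conversely, nonvanishing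
  spreads over orbits, and \<open>f ^ (q - 2)\<close> serves as inverse because \<open>f ^ q\<close>
  is congruent to \<open>f\<close>.\<close>

lemma unit_iff_ev:
  assumes f: "f \<in> reps p m"
  shows "f \<in> unit_reps p m \<longleftrightarrow> (\<forall>j\<in>orbit_reps m p. ev f j \<notin> M)"
proof
  assume "f \<in> unit_reps p m"
  then obtain g where "f * g - 1 \<in> cyc_ideal p m" by (auto simp: unit_reps_def)
  then have "ev (f * g - 1) j \<in> M" for j by (rule ev_mem)
  then have ev1: "ev f j * ev g j - 1 \<in> M" for j by (simp add: ev_diff ev_mult ev_one)
  show "\<forall>j\<in>orbit_reps m p. ev f j \<notin> M"
  proof (intro ballI notI)
    fix j assume "ev f j \<in> M"
    then have "ev f j * ev g j \<in> M" by (rule mult_mem_right)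
    from diff_mem[OF this ev1[of j]] show False using one_notin by simp
  qed
next
  assume ev: "\<forall>j\<in>orbit_reps m p. ev f j \<notin> M"
  have nz: "ev f k \<notin> M" if km: "k < m" for k
  proof
    assume k: "ev f k \<in> M"
    obtain j where j: "j \<in> orbit_reps m p" "k \<in> mult_orbit m p j"
      using ex_orbit_rep[OF cop km] by blast
    obtain i where i: "\<And>f. ev f j ^ (p ^ i) - ev f k \<in> M" using ev_orbit[OF j(2)] by blast
    have "ev f j ^ (p ^ i) \<in> M" by (rule cong_mem[OF i k])
    then have "ev f j \<in> M" by (rule power_mem)
    then show False using ev j(1) by blast
  qed
  define q where "q = p ^ ord m p"
  have "ord m p > 0" using cop by simp
  with prime_gt_1_nat[OF p] have "q > 1" unfolding q_def by (rule one_less_power)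
  then have q: "q = Suc (Suc (q - 2))" by simp
  define h where "h = f ^ (q - 2)"
  have "f * (f * h - 1) = f ^ Suc (Suc (q - 2)) - f"
    by (simp add: h_def algebra_simps)
  then have "f * (f * h - 1) = f ^ q - f" using q by simp
  moreover have "f ^ q - f \<in> cyc_ideal p m"
    unfolding q_def by (rule power_cong_self[OF p]) (rule ord)
  ultimately have "ev (f * (f * h - 1)) k \<in> M" for k by (metis ev_mem)
  then have evh: "ev (f * h - 1) k \<in> M" if "k < m" for k
    using nz[OF that] prime_mem[of "ev f k"] unfolding ev_mult by blast
  \<comment> \<open>Vanishing of all values forces membership in the ideal only for degree below
    \<open>m\<close>, hence the reduction.\<close>
  define r where "r = reduce p m (f * h - 1)"
  have r: "r \<in> reps p m" "f * h - 1 - r \<in> cyc_ideal p m"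
    unfolding r_def using reduce[of p m "f * h - 1"] m prime_gt_0_nat[OF p] by auto
  have "r \<in> cyc_ideal p m"
  proof (rule mem_if_ev)
    show "coeff r i = 0" if "i \<ge> m" for i using r(1) that by (simp add: reps_def)
    show "ev r k \<in> M" if "k < m" for k
      using diff_mem[OF evh[OF that] ev_mem[OF r(2), of k]] by (simp add: ev_diff)
  qed
  with r(2) have "f * h - 1 \<in> cyc_ideal p m" by (rule cyc.cong_mem)
  then show "f \<in> unit_reps p m" using f by (auto simp: unit_reps_def)
qed

text \<open>Under the transform, units correspond to families with all components nonzero.\<close>

lemma card_unit_reps_orbits: "card (unit_reps p m) = (\<Prod>j\<in>orbit_reps m p. field_size j - 1)"
proof -
  let ?Q = "PiE (orbit_reps m p) (\<lambda>j. fixed_residues (field_size j) - {residue 0})"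
  have iff: "f \<in> unit_reps p m \<longleftrightarrow> (\<forall>j\<in>orbit_reps m p. dft f j \<noteq> residue 0)" if "f \<in> reps p m" for f
    using unit_iff_ev[OF that] by (simp add: dft_def residue_eq_iff)
  have sub: "unit_reps p m \<subseteq> reps p m" by (auto simp: unit_reps_def)
  have "dft ` unit_reps p m = ?Q"
  proof (rule equalityI; rule subsetI)
    fix v assume "v \<in> dft ` unit_reps p m"
    then obtain f where f: "f \<in> unit_reps p m" "v = dft f" by (rule imageE)
    have "f \<in> reps p m" by (rule subsetD[OF sub f(1)])
    then have "v \<in> PiE (orbit_reps m p) (\<lambda>j. fixed_residues (field_size j))"
      unfolding f(2) dft_image[symmetric] by (rule imageI)
    then show "v \<in> ?Q" using iff[OF \<open>f \<in> reps p m\<close>] f by (auto simp: PiE_iff)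
  next
    fix v assume v: "v \<in> ?Q"
    then have "v \<in> PiE (orbit_reps m p) (\<lambda>j. fixed_residues (field_size j))" by (auto simp: PiE_iff)
    then obtain f where f: "f \<in> reps p m" "v = dft f" unfolding dft_image[symmetric] by auto
    then have "f \<in> unit_reps p m" using iff[OF f(1)] v by (auto simp: PiE_iff)
    then show "v \<in> dft ` unit_reps p m" unfolding f(2) by (rule imageI)
  qed
  moreover have "inj_on dft (unit_reps p m)" by (rule inj_on_subset[OF inj_on_dft sub])
  ultimately have "card (unit_reps p m) = card ?Q" by (metis card_image)
  also have "\<dots> = (\<Prod>j\<in>orbit_reps m p. card (fixed_residues (field_size j) - {residue 0}))"
    by (rule card_PiE) (rule finite_orbit_reps)
  also have "\<dots> = (\<Prod>j\<in>orbit_reps m p. field_size j - 1)"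
  proof (rule prod.cong[OF refl])
    fix j assume "j \<in> orbit_reps m p"
    moreover have "residue 0 \<in> fixed_residues (field_size j)"
      using field_size_gt_1[of j] by (intro zero_mem_fixed_residues) linarith
    ultimately show "card (fixed_residues (field_size j) - {residue 0}) = field_size j - 1"
      by (simp add: card_Diff_singleton card_fixed_residues)
  qed
  finally show ?thesis .
qed

end

lemma card_unit_reps_coprime:
  assumes "prime p" "m > 0" "coprime m p"
  shows "card (unit_reps p m) = (\<Prod>d | d dvd m. (p ^ ord d p - 1) ^ (totient d div ord d p))"
proof -
  obtain M where "ring_prime_ideal M" "cyc_ideal p m \<subseteq> M" "\<forall>i. monom 1 i - 1 \<in> M \<longrightarrow> m dvd i"
    using ex_prime_ideal_primitive[OF assms(1,3,2)] by blast
  then interpret primitive_root_ideal M p m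
    using assms by (intro primitive_root_ideal.intro primitive_root_ideal_axioms.intro) auto
  have "card {j \<in> orbit_reps m p. m div gcd j m = d} = totient d div ord d p" if "d dvd m" for d
  proof -
    have "ord d p > 0" by (rule ord_pos_if_dvd[OF assms(3) that])
    \<comment> \<open>The division is exact, since \<open>totient d\<close> is the number of orbits
      times their length.\<close>
    then show ?thesis unfolding card_orbit_reps_class[OF assms(3,2) that, symmetric] by simp
  qed
  then show ?thesis
    unfolding card_unit_reps_orbits orbit_reps_group(2)[OF assms(2), of "\<lambda>d. p ^ ord d p - 1"]
    by (intro prod.cong) auto
qed

section \<open>Circulant matrices\<close>

abbreviation zquot :: "nat \<Rightarrow> int \<Rightarrow> int set" where
  "zquot a \<equiv> ZMod (int a)"

lemma ring_hom_ring_ZMod: "ring_hom_ring \<Z> (ZFact k) (ZMod k)"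
proof -
  have "ring_hom_ring \<Z> (\<Z> Quot Idl\<^bsub>\<Z>\<^esub> {k}) ((+>\<^bsub>\<Z>\<^esub>) (Idl\<^bsub>\<Z>\<^esub> {k}))"
    by (rule ideal.rcos_ring_hom_ring) (rule int.genideal_ideal, simp)
  moreover have "ZMod k = (+>\<^bsub>\<Z>\<^esub>) (Idl\<^bsub>\<Z>\<^esub> {k})" by (simp add: fun_eq_iff ZMod_def)
  ultimately show ?thesis by (simp add: ZFact_def)
qed

lemma ZMod_in_carrier: "ZMod k x \<in> carrier (ZFact k)"
  by (auto simp: ZFact_def FactRing_def A_RCOSETS_def' ZMod_def)

lemma ZFact_carrierE:
  assumes "y \<in> carrier (ZFact k)"
  obtains x where "y = ZMod k x"
  using assms by (auto simp: ZFact_def FactRing_def A_RCOSETS_def' ZMod_def)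

lemma ZMod_eq_iff: "ZMod k x = ZMod k y \<longleftrightarrow> k dvd x - y"
  by (metis ZMod_imp_zmod zmod_imp_ZMod mod_eq_dvd_iff)

lemma ZMod_one: "ZMod k 1 = \<one>\<^bsub>ZFact k\<^esub>"
  using ring_hom_memE(4)[OF ring_hom_ring.homh[OF ring_hom_ring_ZMod[of k]]] by simp

lemma ZMod_zero: "ZMod k 0 = \<zero>\<^bsub>ZFact k\<^esub>"
proof -
  interpret ring_hom_ring \<Z> "ZFact k" "ZMod k" by (rule ring_hom_ring_ZMod)
  show ?thesis using hom_zero by simp
qed

lemma ZMod_mult: "ZMod k (x * y) = ZMod k x \<otimes>\<^bsub>ZFact k\<^esub> ZMod k y"
  using ring_hom_memE(2)[OF ring_hom_ring.homh[OF ring_hom_ring_ZMod[of k]], of x y] by simp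

lemma ZMod_add: "ZMod k (x + y) = ZMod k x \<oplus>\<^bsub>ZFact k\<^esub> ZMod k y"
  using ring_hom_memE(3)[OF ring_hom_ring.homh[OF ring_hom_ring_ZMod[of k]], of x y] by simp

lemma ZMod_sum:
  assumes "finite S"
  shows "ZMod k (sum F S) = (\<Oplus>\<^bsub>ZFact k\<^esub>i\<in>S. ZMod k (F i))"
proof -
  interpret R: cring "ZFact k" by (rule ZFact_is_cring)
  show ?thesis using assms
    by (induction S rule: finite_induct) (auto simp: ZMod_zero ZMod_add ZMod_in_carrier)
qed

section \<open>Index subtraction modulo \<open>n\<close> and cyclic convolution\<close>

definition cyc_diff :: "nat \<Rightarrow> nat \<Rightarrow> nat \<Rightarrow> nat" where
  "cyc_diff n i k = (i + n - k) mod n"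

lemma cyc_diff_less: "n > 0 \<Longrightarrow> cyc_diff n i k < n"
  by (simp add: cyc_diff_def)

lemma int_cyc_diff:
  assumes "k \<le> n"
  shows "int (cyc_diff n i k) = (int i - int k) mod int n"
proof -
  have "int (i + n - k) = (int i - int k) + int n" using assms by simp
  then show ?thesis by (simp only: cyc_diff_def of_nat_mod mod_add_self2)
qed

lemma cyc_diff_add:
  assumes "l < n" "k < n"
  shows "cyc_diff n ((l + k) mod n) k = l"
proof -
  have "int (cyc_diff n ((l + k) mod n) k) = int l"
    using assms by (simp add: int_cyc_diff zmod_int mod_simps)
  then show ?thesis by simp
qed

lemma add_cyc_diff:
  assumes "i < n" "k < n"
  shows "(cyc_diff n i k + k) mod n = i"
proof -
  have "int ((cyc_diff n i k + k) mod n) = int i"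
    using assms by (simp add: int_cyc_diff zmod_int mod_simps)
  then show ?thesis by simp
qed

lemma cyc_diff_Suc:
  assumes "j < n"
  shows "cyc_diff n i ((j + 1) mod n) = cyc_diff n (cyc_diff n i 1) j"
proof -
  have "(j + 1) mod n \<le> n" using assms by (intro less_imp_le mod_less_divisor) simp
  then have "int (cyc_diff n i ((j + 1) mod n)) = (int i - (int j + 1) mod int n) mod int n"
    by (simp add: int_cyc_diff zmod_int add.commute)
  also have "\<dots> = ((int i - 1) mod int n - int j) mod int n"
    by (simp add: mod_simps algebra_simps)
  also have "\<dots> = int (cyc_diff n (cyc_diff n i 1) j)"
    using assms by (simp add: int_cyc_diff)
  finally show ?thesis by simp
qed

lemma cyc_diff_cyc_diff:
  assumes "j < n" "k < n"
  shows "cyc_diff n (cyc_diff n i j) (cyc_diff n k j) = cyc_diff n i k"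
proof -
  have "int (cyc_diff n (cyc_diff n i j) (cyc_diff n k j)) = int (cyc_diff n i k)"
    using assms cyc_diff_less[of n k j] by (simp add: int_cyc_diff less_imp_le mod_simps)
  then show ?thesis by simp
qed

lemma cyc_diff_eq_0_iff:
  assumes "i < n" "j < n"
  shows "cyc_diff n i j = 0 \<longleftrightarrow> i = j"
proof
  assume "cyc_diff n i j = 0"
  then show "i = j" using add_cyc_diff[OF assms] assms(2) by simp
next
  assume "i = j"
  then show "cyc_diff n i j = 0" by (simp add: cyc_diff_def)
qed

definition conv :: "nat \<Rightarrow> int poly \<Rightarrow> int poly \<Rightarrow> nat \<Rightarrow> int" where
  "conv n f g i = (\<Sum>k<n. coeff f (cyc_diff n i k) * coeff g k)"

text \<open>Folding the exponents \<open>l + k\<close> of the product modulo \<open>n\<close> turns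
  multiplication of polynomials into cyclic convolution.\<close>

lemma mult_conv_cong:
  assumes f: "\<And>i. i \<ge> n \<Longrightarrow> coeff f i = 0" and g: "\<And>i. i \<ge> n \<Longrightarrow> coeff g i = 0" and n: "n > 0"
  shows "f * g - (\<Sum>i<n. monom (conv n f g i) i) \<in> cyc_ideal a n"
proof -
  have "f * g = (\<Sum>l<n. monom (coeff f l) l) * (\<Sum>k<n. monom (coeff g k) k)"
    using sum_monom_coeff[of n f] sum_monom_coeff[of n g] f g by simp
  also have "\<dots> = (\<Sum>k<n. \<Sum>l<n. monom (coeff f l * coeff g k) (l + k))"
    by (subst sum.swap) (simp add: sum_product mult_monom)
  finally have fg: "f * g = (\<Sum>k<n. \<Sum>l<n. monom (coeff f l * coeff g k) (l + k))" .
  have "(\<Sum>l<n. monom (coeff f l * coeff g k) ((l + k) mod n)) =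
      (\<Sum>i<n. monom (coeff f (cyc_diff n i k) * coeff g k) i)" if k: "k < n" for k
    by (rule sum.reindex_bij_witness[where i = "\<lambda>i. cyc_diff n i k" and j = "\<lambda>l. (l + k) mod n"])
      (use n k in \<open>auto simp: cyc_diff_add add_cyc_diff cyc_diff_less\<close>)
  then have "(\<Sum>k<n. \<Sum>l<n. monom (coeff f l * coeff g k) ((l + k) mod n)) =
      (\<Sum>k<n. \<Sum>i<n. monom (coeff f (cyc_diff n i k) * coeff g k) i)"
    by (rule sum.cong[OF refl]) simp
  also have "\<dots> = (\<Sum>i<n. monom (conv n f g i) i)"
    by (subst sum.swap) (simp add: conv_def monom_sum)
  finally have "(\<Sum>i<n. monom (conv n f g i) i) =
      (\<Sum>k<n. \<Sum>l<n. monom (coeff f l * coeff g k) ((l + k) mod n))" ..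
  then show ?thesis
    unfolding fg by (simp only:) (intro cyc.cong_sum monom_mod_cong)
qed

lemma conv_unit_iff:
  assumes f: "\<And>i. i \<ge> n \<Longrightarrow> coeff f i = 0" and g: "\<And>i. i \<ge> n \<Longrightarrow> coeff g i = 0" and n: "n > 0"
  shows "f * g - 1 \<in> cyc_ideal a n \<longleftrightarrow> (\<forall>i<n. int a dvd conv n f g i - (if i = 0 then 1 else 0))"
proof -
  define c where "c = (\<Sum>i<n. monom (conv n f g i) i)"
  have "f * g - c \<in> cyc_ideal a n" unfolding c_def by (rule mult_conv_cong[OF f g n])
  then have "f * g - 1 \<in> cyc_ideal a n \<longleftrightarrow> c - 1 \<in> cyc_ideal a n"
    using cyc.cong_trans cyc.cong_sym by blast
  also have "\<dots> \<longleftrightarrow> (\<forall>i. int a dvd coeff (c - 1) i)"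
  proof
    assume "c - 1 \<in> cyc_ideal a n"
    then show "\<forall>i. int a dvd coeff (c - 1) i"
      using n by (intro allI mem_cyc_ideal_coeff_dvd) (auto simp: c_def coeff_sum_monom)
  next
    assume "\<forall>i. int a dvd coeff (c - 1) i"
    then show "c - 1 \<in> cyc_ideal a n"
      by (intro of_nat_dvd_mem) (rule of_nat_dvd_iff_coeff[THEN iffD2])
  qed
  also have "\<dots> \<longleftrightarrow> (\<forall>i<n. int a dvd conv n f g i - (if i = 0 then 1 else 0))"
    using n by (auto simp: c_def coeff_sum_monom)
  finally show ?thesis .
qed

text \<open>The matrix of multiplication by \<open>f\<close> in the basis
  \<open>1, X, ..., X^(n-1)\<close>; its first column lists the coefficients of
  \<open>f\<close>.\<close>

definition circ_mat :: "nat \<Rightarrow> nat \<Rightarrow> int poly \<Rightarrow> int set mat" where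
  "circ_mat a n f = mat n n (\<lambda>(i, j). zquot a (coeff f (cyc_diff n i j)))"

lemma circ_mat_index:
  "i < n \<Longrightarrow> j < n \<Longrightarrow> circ_mat a n f $$ (i, j) = zquot a (coeff f (cyc_diff n i j))"
  by (simp add: circ_mat_def)

lemma circ_mat_carrier: "circ_mat a n f \<in> carrier_mat n n"
  by (simp add: circ_mat_def)

lemma circ_mat_in_carrier: "circ_mat a n f \<in> carrier (square_mats (ZFact (int a)) n)"
proof -
  have "elements_mat (circ_mat a n f) \<subseteq> carrier (ZFact (int a))"
  proof
    fix x assume "x \<in> elements_mat (circ_mat a n f)"
    then obtain i j where "i < n" "j < n" "x = circ_mat a n f $$ (i, j)"
      using elements_matD[of x "circ_mat a n f"] circ_mat_carrier[of a n f] by auto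
    then show "x \<in> carrier (ZFact (int a))" by (simp add: circ_mat_index ZMod_in_carrier)
  qed
  then show ?thesis by (simp add: square_mats_def circ_mat_carrier)
qed

lemma circulant_circ_mat: "circulant n (circ_mat a n f)"
  unfolding circulant_def
proof (intro conjI allI impI circ_mat_carrier)
  fix i j assume ij: "i < n" "j < n"
  have "circ_mat a n f $$ (i, (j + 1) mod n) = zquot a (coeff f (cyc_diff n (cyc_diff n i 1) j))"
    using ij by (subst circ_mat_index) (auto simp only: cyc_diff_Suc intro: mod_less_divisor)
  also have "\<dots> = circ_mat a n f $$ (cyc_diff n i 1, j)"
    using ij by (simp add: circ_mat_index cyc_diff_less)
  finally show "circ_mat a n f $$ (i, (j + 1) mod n) = circ_mat a n f $$ ((i + n - 1) mod n, j)"
    by (simp only: cyc_diff_def)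
qed

text \<open>Each step one column to the left lowers the row index by one modulo \<open>n\<close>,
  until the first column is reached.\<close>

lemma circulant_index:
  assumes "circulant n A" "i < n" "j < n"
  shows "A $$ (i, j) = A $$ (cyc_diff n i j, 0)"
  using assms(2,3)
proof (induction j arbitrary: i)
  case (Suc j)
  have j: "(j + 1) mod n = Suc j" using Suc.prems by simp
  have "A $$ (i, (j + 1) mod n) = A $$ ((i + n - 1) mod n, j)"
    using assms(1) Suc.prems unfolding circulant_def by (metis Suc_lessD)
  also have "\<dots> = A $$ (cyc_diff n i 1, j)" by (simp only: cyc_diff_def)
  also have "\<dots> = A $$ (cyc_diff n (cyc_diff n i 1) j, 0)"
    using Suc.prems by (intro Suc.IH) (auto simp: cyc_diff_less)
  also have "\<dots> = A $$ (cyc_diff n i ((j + 1) mod n), 0)"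
    using Suc.prems by (simp only: cyc_diff_Suc Suc_lessD)
  finally show ?case unfolding j .
qed (simp add: cyc_diff_def)

lemma bij_betw_circ_mat:
  assumes a: "a > 0" and n: "n > 0"
  shows "bij_betw (circ_mat a n) (reps a n) {A \<in> carrier (square_mats (ZFact (int a)) n). circulant n A}"
proof (rule bij_betw_imageI)
  show "inj_on (circ_mat a n) (reps a n)"
  proof (rule inj_onI)
    fix f g assume f: "f \<in> reps a n" and g: "g \<in> reps a n" and eq: "circ_mat a n f = circ_mat a n g"
    have "int a dvd coeff (f - g) i" for i
    proof (cases "i < n")
      case True
      then have "zquot a (coeff f i) = zquot a (coeff g i)"
        using circ_mat_index[of i n 0 a f] circ_mat_index[of i n 0 a g] eq by (simp add: cyc_diff_def)
      then show ?thesis by (simp add: ZMod_eq_iff)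
    qed (use f g in \<open>auto simp: reps_def\<close>)
    then have "f - g \<in> cyc_ideal a n"
      by (intro of_nat_dvd_mem) (simp only: of_nat_dvd_iff_coeff simp_thms)
    then show "f = g" by (rule reps_cong_eq[OF f g _ n])
  qed
  show "circ_mat a n ` reps a n = {A \<in> carrier (square_mats (ZFact (int a)) n). circulant n A}"
  proof (intro equalityI subsetI)
    fix A assume "A \<in> circ_mat a n ` reps a n"
    then show "A \<in> {A \<in> carrier (square_mats (ZFact (int a)) n). circulant n A}"
      using circ_mat_in_carrier circulant_circ_mat by auto
  next
    fix A assume "A \<in> {A \<in> carrier (square_mats (ZFact (int a)) n). circulant n A}"
    then have A: "A \<in> carrier_mat n n" "elements_mat A \<subseteq> carrier (ZFact (int a))" "circulant n A"
      by (auto simp: square_mats_def)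
    have "\<exists>x. A $$ (i, 0) = zquot a x" if "i < n" for i
    proof -
      have "A $$ (i, 0) \<in> carrier (ZFact (int a))"
        using A that n by (blast intro: elements_matI)
      then show ?thesis by (metis ZFact_carrierE)
    qed
    then obtain c where c: "\<And>i. i < n \<Longrightarrow> A $$ (i, 0) = zquot a (c i)" by metis
    define f where "f = (\<Sum>i<n. monom (c i mod int a) i)"
    have f: "f \<in> reps a n" using a by (auto simp: reps_def f_def coeff_sum_monom)
    have "A = circ_mat a n f"
    proof (rule eq_matI)
      fix i j assume "i < dim_row (circ_mat a n f)" "j < dim_col (circ_mat a n f)"
      then have ij: "i < n" "j < n" by (simp_all add: circ_mat_def)
      have "A $$ (i, j) = zquot a (c (cyc_diff n i j))"
        using circulant_index[OF A(3) ij] c n by (simp add: cyc_diff_less)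
      also have "\<dots> = zquot a (c (cyc_diff n i j) mod int a)" by (rule ZMod_mod)
      also have "\<dots> = circ_mat a n f $$ (i, j)"
        using ij n by (simp add: circ_mat_index f_def coeff_sum_monom cyc_diff_less)
      finally show "A $$ (i, j) = circ_mat a n f $$ (i, j)" .
    qed (use A(1) in \<open>auto simp: circ_mat_def\<close>)
    then show "A \<in> circ_mat a n ` reps a n" using f by blast
  qed
qed

lemma square_mats_mult_index:
  assumes "i < n" "j < n" "\<And>k. k < n \<Longrightarrow> A $$ (i, k) = ZMod c (F k)" "\<And>k. k < n \<Longrightarrow> B $$ (k, j) = ZMod c (G k)"
  shows "(A \<otimes>\<^bsub>square_mats (ZFact c) n\<^esub> B) $$ (i, j) = ZMod c (\<Sum>k<n. F k * G k)"
proof -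
  interpret R: cring "ZFact c" by (rule ZFact_is_cring)
  have "(\<Oplus>\<^bsub>ZFact c\<^esub>k\<in>{..<n}. A $$ (i, k) \<otimes>\<^bsub>ZFact c\<^esub> B $$ (k, j)) = (\<Oplus>\<^bsub>ZFact c\<^esub>k\<in>{..<n}. ZMod c (F k * G k))"
    using assms by (intro R.finsum_cong') (auto simp: ZMod_mult ZMod_in_carrier)
  then show ?thesis using assms(1,2) by (simp add: square_mats_def ZMod_sum)
qed

lemma square_mats_one_index:
  assumes "i < n" "j < n"
  shows "\<one>\<^bsub>square_mats (ZFact c) n\<^esub> $$ (i, j) = ZMod c (if i = j then 1 else 0)"
  using assms by (simp add: square_mats_def ZMod_one ZMod_zero)

lemma circ_mat_mult_eq_one:
  assumes f: "\<And>i. i \<ge> n \<Longrightarrow> coeff f i = 0" and g: "\<And>i. i \<ge> n \<Longrightarrow> coeff g i = 0"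
    and n: "n > 0" and fg: "f * g - 1 \<in> cyc_ideal a n"
  shows "circ_mat a n f \<otimes>\<^bsub>square_mats (ZFact (int a)) n\<^esub> circ_mat a n g = \<one>\<^bsub>square_mats (ZFact (int a)) n\<^esub>"
proof (rule eq_matI)
  fix i j
  assume "i < dim_row \<one>\<^bsub>square_mats (ZFact (int a)) n\<^esub>" "j < dim_col \<one>\<^bsub>square_mats (ZFact (int a)) n\<^esub>"
  then have ij: "i < n" "j < n" by (simp_all add: square_mats_def)
  define l where "l = cyc_diff n i j"
  \<comment> \<open>Shifting \<open>k\<close> by \<open>j\<close> turns the matrix entry into the
    convolution at \<open>i - j\<close>.\<close>
  have "(\<Sum>k<n. coeff f (cyc_diff n i k) * coeff g (cyc_diff n k j)) = conv n f g l"
    unfolding conv_def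
    by (rule sum.reindex_bij_witness[where j = "\<lambda>k. cyc_diff n k j" and i = "\<lambda>k. (k + j) mod n"])
      (use n ij in \<open>auto simp: l_def cyc_diff_add add_cyc_diff cyc_diff_less cyc_diff_cyc_diff\<close>)
  then have "(circ_mat a n f \<otimes>\<^bsub>square_mats (ZFact (int a)) n\<^esub> circ_mat a n g) $$ (i, j) = zquot a (conv n f g l)"
    using square_mats_mult_index[OF ij, of "circ_mat a n f" "int a" "\<lambda>k. coeff f (cyc_diff n i k)"
        "circ_mat a n g" "\<lambda>k. coeff g (cyc_diff n k j)"] ij by (simp add: circ_mat_index)
  moreover have "l < n" using n by (simp add: l_def cyc_diff_less)
  then have "int a dvd conv n f g l - (if l = 0 then 1 else 0)"
    using conv_unit_iff[of n f g a] f g n fg by blast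
  then have "zquot a (conv n f g l) = zquot a (if l = 0 then 1 else 0)"
    by (simp only: ZMod_eq_iff)
  moreover have "l = 0 \<longleftrightarrow> i = j" unfolding l_def by (rule cyc_diff_eq_0_iff[OF ij])
  ultimately show "(circ_mat a n f \<otimes>\<^bsub>square_mats (ZFact (int a)) n\<^esub> circ_mat a n g) $$ (i, j) =
      \<one>\<^bsub>square_mats (ZFact (int a)) n\<^esub> $$ (i, j)"
    by (simp add: square_mats_one_index[OF ij])
qed (simp_all add: square_mats_def)

text \<open>Only the first column of an inverse matrix is needed to invert \<open>f\<close>, so no separate argument
  is required that inverses of circulant matrices are circulant.\<close>

lemma circ_mat_Units_iff:
  assumes a: "a > 0" and n: "n > 0" and f: "f \<in> reps a n"
  shows "circ_mat a n f \<in> Units (square_mats (ZFact (int a)) n) \<longleftrightarrow> f \<in> unit_reps a n"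
proof
  have deg: "coeff f i = 0" if "i \<ge> n" for i using f that by (simp add: reps_def)
  {
    assume "circ_mat a n f \<in> Units (square_mats (ZFact (int a)) n)"
    then obtain B where B: "B \<in> carrier (square_mats (ZFact (int a)) n)"
      and inv: "circ_mat a n f \<otimes>\<^bsub>square_mats (ZFact (int a)) n\<^esub> B = \<one>\<^bsub>square_mats (ZFact (int a)) n\<^esub>"
      by (auto simp: Units_def)
    have "\<exists>x. B $$ (k, 0) = zquot a x" if "k < n" for k
    proof -
      have "B \<in> carrier_mat n n" "elements_mat B \<subseteq> carrier (ZFact (int a))"
        using B by (auto simp: square_mats_def)
      then have "B $$ (k, 0) \<in> carrier (ZFact (int a))"
        using that n by (blast intro: elements_matI)
      then show ?thesis by (metis ZFact_carrierE)
    qed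
    then obtain b where b: "\<And>k. k < n \<Longrightarrow> B $$ (k, 0) = zquot a (b k)" by metis
    \<comment> \<open>The first column of \<open>B\<close>, lifted to integers, is read as a
      polynomial.\<close>
    define g where "g = (\<Sum>k<n. monom (b k) k)"
    have g: "coeff g k = (if k < n then b k else 0)" for k by (simp add: g_def coeff_sum_monom)
    have "int a dvd conv n f g i - (if i = 0 then 1 else 0)" if i: "i < n" for i
    proof -
      have "zquot a (conv n f g i) = (circ_mat a n f \<otimes>\<^bsub>square_mats (ZFact (int a)) n\<^esub> B) $$ (i, 0)"
        unfolding conv_def
        by (rule square_mats_mult_index[symmetric, OF i n]) (auto simp: circ_mat_index i b g)
      also have "\<dots> = zquot a (if i = 0 then 1 else 0)"
        unfolding inv by (rule square_mats_one_index[OF i n])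
      finally show ?thesis by (simp only: ZMod_eq_iff)
    qed
    then have "f * g - 1 \<in> cyc_ideal a n" using conv_unit_iff[OF deg _ n, of g a] g by simp
    then show "f \<in> unit_reps a n" using f by (auto simp: unit_reps_def)
  }
  assume "f \<in> unit_reps a n"
  then obtain g' where g': "f * g' - 1 \<in> cyc_ideal a n" by (auto simp: unit_reps_def)
  define g where "g = reduce a n g'"
  have g: "g \<in> reps a n" "g' - g \<in> cyc_ideal a n" unfolding g_def by (rule reduce[OF a n])+
  have deg': "coeff g i = 0" if "i \<ge> n" for i using g(1) that by (simp add: reps_def)
  \<comment> \<open>\<open>Units\<close> requires a two-sided inverse, so both orders of the product
    are prepared.\<close>
  have gf: "g * f - 1 \<in> cyc_ideal a n"
    using cyc.unit_cong[OF g(2), of f] g' by (simp add: mult.commute)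
  then have fg: "f * g - 1 \<in> cyc_ideal a n" by (simp add: mult.commute)
  show "circ_mat a n f \<in> Units (square_mats (ZFact (int a)) n)"
    unfolding Units_def
    by (intro CollectI conjI bexI[of _ "circ_mat a n g"] circ_mat_in_carrier
        circ_mat_mult_eq_one[OF deg' deg n gf] circ_mat_mult_eq_one[OF deg deg' n fg])
qed

lemma order_RC_eq_card_unit_reps:
  assumes "a > 0" "n > 0"
  shows "Coset.order (RC n (ZFact (int a))) = card (unit_reps a n)"
proof -
  note bij = bij_betw_circ_mat[OF assms]
  have sub: "unit_reps a n \<subseteq> reps a n" by (auto simp: unit_reps_def)
  have "carrier (RC n (ZFact (int a))) = circ_mat a n ` unit_reps a n"
  proof (intro equalityI subsetI)
    fix A assume "A \<in> carrier (RC n (ZFact (int a)))"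
    then have A: "A \<in> Units (square_mats (ZFact (int a)) n)" "circulant n A"
      by (auto simp: RC_def)
    then have "A \<in> circ_mat a n ` reps a n"
      using bij_betw_imp_surj_on[OF bij] by (auto simp: Units_def)
    then show "A \<in> circ_mat a n ` unit_reps a n" using A(1) circ_mat_Units_iff[OF assms] by auto
  next
    fix A assume "A \<in> circ_mat a n ` unit_reps a n"
    then show "A \<in> carrier (RC n (ZFact (int a)))"
      using circ_mat_Units_iff[OF assms] sub circulant_circ_mat by (auto simp: RC_def)
  qed
  moreover have "inj_on (circ_mat a n) (unit_reps a n)"
    using bij_betw_imp_inj_on[OF bij] sub by (rule inj_on_subset)
  ultimately show ?thesis by (simp add: Coset.order_def card_image)
qed

section \<open>Prime factorization and the final formula\<close>

lemma card_unit_reps_1: "card (unit_reps 1 n) = 1"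
proof -
  have "f \<in> cyc_ideal 1 n" for f by (rule of_nat_dvd_mem) (simp only: of_nat_1 one_dvd)
  then have "unit_reps 1 n = reps 1 n" by (simp add: unit_reps_def)
  then show ?thesis by (simp only: card_reps power_one)
qed

lemma card_unit_reps_prod:
  assumes "finite S" "\<And>p. p \<in> S \<Longrightarrow> prime p" "n > 0"
  shows "card (unit_reps (\<Prod>p\<in>S. p ^ t p) n) = (\<Prod>p\<in>S. card (unit_reps (p ^ t p) n))"
  using assms(1,2)
proof (induction S rule: finite_induct)
  case empty
  show ?case by (simp only: prod.empty card_unit_reps_1)
next
  case (insert p S)
  have "coprime (p ^ t p) (\<Prod>q\<in>S. q ^ t q)"
  proof (rule prod_coprime_right)
    fix q assume "q \<in> S"
    then have "p \<noteq> q" using insert.hyps by auto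
    moreover have "prime p" "prime q" using \<open>q \<in> S\<close> by (simp_all add: insert.prems)
    ultimately have "coprime p q" by (intro primes_coprime)
    then show "coprime (p ^ t p) (q ^ t q)" by simp
  qed
  moreover have "p ^ t p > 0" "(\<Prod>q\<in>S. q ^ t q) > 0"
    by (simp_all add: prime_gt_0_nat insert.prems prod_pos)
  ultimately have "card (unit_reps (p ^ t p * (\<Prod>q\<in>S. q ^ t q)) n) =
      card (unit_reps (p ^ t p) n) * card (unit_reps (\<Prod>q\<in>S. q ^ t q) n)"
    using assms(3) by (rule card_unit_reps_mult)
  also have "card (unit_reps (\<Prod>q\<in>S. q ^ t q) n) = (\<Prod>q\<in>S. card (unit_reps (q ^ t q) n))"
    by (rule insert.IH) (rule insert.prems, rule insertI2)
  finally show ?case by (simp only: prod.insert[OF insert.hyps])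
qed

text \<open>The lifting factor has exponent
  \<open>t * n - m = n * (t - 1) + (p ^ r - 1) * m\<close>, and writing \<open>m\<close> as the
  divisor sum of \<open>totient\<close> distributes the last part over the divisors
  \<open>d\<close>.\<close>

lemma card_unit_reps_prime_power_eq:
  assumes "prime p" "n = p ^ r * m" "\<not> p dvd m" "n > 0" "t > 0"
  shows "card (unit_reps (p ^ t) n) = p ^ (n * (t - 1)) *
    (\<Prod>d\<in>{d. d dvd m}. (p ^ ord d p - 1) ^ (totient d div ord d p) * p ^ ((p ^ r - 1) * totient d))"
proof -
  have m: "m > 0" using assms(2,4) by (cases m) auto
  have cop: "coprime m p"
    using prime_imp_coprime[OF assms(1,3)] by (rule coprime_commute[THEN iffD1])
  have tn: "t * n = n * (t - 1) + n" using assms(5) by (cases t) simp_all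
  have pm: "p ^ r * m = (p ^ r - 1) * m + m"
    using prime_gt_0_nat[OF assms(1)] by (cases "p ^ r") simp_all
  have exp: "t * n = n * (t - 1) + ((p ^ r - 1) * m + m)"
    unfolding pm[symmetric] assms(2)[symmetric] by (rule tn)
  have "(\<Prod>d | d dvd m. p ^ ((p ^ r - 1) * totient d)) = p ^ (\<Sum>d | d dvd m. (p ^ r - 1) * totient d)"
    by (rule power_sum[symmetric])
  also have "\<dots> = p ^ ((p ^ r - 1) * m)"
    by (simp only: sum_distrib_left[symmetric, where f = totient] totient_divisor_sum)
  finally have prod: "(\<Prod>d | d dvd m. (p ^ ord d p - 1) ^ (totient d div ord d p) * p ^ ((p ^ r - 1) * totient d)) =
      card (unit_reps p m) * p ^ ((p ^ r - 1) * m)"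
    by (simp only: prod.distrib card_unit_reps_coprime[OF assms(1) m cop])
  have "card (unit_reps (p ^ t) n) * p ^ m = card (unit_reps p m) * p ^ (t * n)"
    by (rule card_unit_reps_prime_power[OF assms(1,2,4,5)])
  also have "\<dots> = (p ^ (n * (t - 1)) * (card (unit_reps p m) * p ^ ((p ^ r - 1) * m))) * p ^ m"
    unfolding exp power_add by (simp only: mult_ac)
  finally have "card (unit_reps (p ^ t) n) * p ^ m =
      (p ^ (n * (t - 1)) * (card (unit_reps p m) * p ^ ((p ^ r - 1) * m))) * p ^ m" .
  moreover have "p ^ m \<noteq> 0" using prime_gt_0_nat[OF assms(1)] by simp
  ultimately show ?thesis unfolding prod by (metis mult_right_cancel)
qed

theorem theorem1p2:
  fixes a n :: nat and t r m :: "nat \<Rightarrow> nat"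
  assumes "a > 0" and "n > 0"
    and "a = (\<Prod>p\<in>prime_factors a. p ^ t p)"
    and "\<And>p. p \<in> prime_factors a \<Longrightarrow> n = p ^ r p * m p \<and> \<not> p dvd m p"
  shows "Coset.order (RC n (ZFact (int a))) =
    (\<Prod>p\<in>prime_factors a.
       p ^ (n * (t p - 1)) *
       (\<Prod>d\<in>{d. d dvd m p}.
          (p ^ ord d p - 1) ^ (totient d div ord d p) * p ^ ((p ^ r p - 1) * totient d)))"
proof -
  \<comment> \<open>Positivity, which keeps \<open>t p - 1\<close> from truncating, follows from the
    factorization: \<open>p\<close> divides some \<open>q ^ t q\<close>, and then
    \<open>q = p\<close>.\<close>
  have t: "t p > 0" if p: "p \<in> prime_factors a" for p
  proof -
    have "prime p" "p dvd (\<Prod>p\<in>prime_factors a. p ^ t p)" using p assms(3) by auto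
    then obtain q where q: "q \<in> prime_factors a" "p dvd q ^ t q"
      by (auto simp: prime_dvd_prod_iff)
    then have "p = q" using \<open>prime p\<close> by (intro primes_dvd_imp_eq) (auto dest: prime_dvd_power)
    with q(2) \<open>prime p\<close> show ?thesis by (cases "t p = 0") auto
  qed
  have "Coset.order (RC n (ZFact (int a))) = card (unit_reps a n)"
    by (rule order_RC_eq_card_unit_reps[OF assms(1,2)])
  also have "\<dots> = (\<Prod>p\<in>prime_factors a. card (unit_reps (p ^ t p) n))"
    by (subst assms(3), rule card_unit_reps_prod) (use assms(2) in auto)
  also have "\<dots> = (\<Prod>p\<in>prime_factors a.
       p ^ (n * (t p - 1)) *
       (\<Prod>d\<in>{d. d dvd m p}.
          (p ^ ord d p - 1) ^ (totient d div ord d p) * p ^ ((p ^ r p - 1) * totient d)))"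
    using assms(2,4) t by (intro prod.cong refl card_unit_reps_prime_power_eq) auto
  finally show ?thesis .
qed

end
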